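(* Assume that, for every 2D SLP $G = (V_{l}, V_{h}, V_{v}, \Sigma, R, S)$, where $\Sigma = \{0,1\}$, representing a 2D string $T \in \Sigma^{r \times c}$, there exists a data structure of size $\mathcal{O}(|G| \cdot \log^{\mathcal{O}(1)} n)$ that answers one of the following query types: (a) sum queries, (b) all-zero queries, (c) square all-zero queries, (d) equality queries, (e) square LCE queries, (f) line LCE queries, on $T$ in $\mathcal{O}(\log^{\mathcal{O}(1)} n)$ time, where $n = \max(r, c)$. Then, for every 1D SLP $\hat{G} = (\hat{V}, \hat{\Sigma}, \hat{R}, \hat{S})$ representing $\hat{T} \in \hat{\Sigma}^{\hat{n}}$, where $\hat{\Sigma} = [0 \mathinner{.\,.} \hat{\sigma})$ and $\hat{\sigma} = \hat{n}^{\mathcal{O}(1)}$, there exists a data structure of size $\mathcal{O}(|\hat{G}| \cdot \log^{\mathcal{O}(1)} \hat{n})$ that answers symbol occurrence queries on $\hat{T}$ in $\mathcal{O}(\log^{\mathcal{O}(1)} \hat{n})$ time.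
   Context: A 1D SLP is a straight-line grammar in which every nonterminal $N$ has a unique rule $N \to AB$ with $A,B$ nonterminals or $N \to a$ with $a$ a terminal, acyclic; it represents the unique string derived from the start symbol. A 2D SLP $G=(V_l,V_h,V_v,\Sigma,R,S)$ has literal nonterminals ($N \to a$, expanding to the $1\times 1$ matrix $a$), horizontal nonterminals $N \to AB$ whose expansion is the expansion of $A$ on top of that of $B$ (equal column counts), and vertical nonterminals $N \to AB$ whose expansion is the expansion of $A$ to the left of that of $B$ (equal row counts), acyclic; it represents the expansion of $S$. Grammar size is $|G| = \sum_{N} \max(|\mathrm{rhs}(N)|,1)$. For $T \in \mathbb{Z}_{\ge 0}^{r \times c}$ (or $T \in \Sigma^{r\times c}$ for the last three): a sum query, given $b_r,e_r \in [0 \mathinner{.\,.} r]$, $b_c,e_c \in [0 \mathinner{.\,.} c]$, returns $\sum_{(i,j) \in (b_r \mathinner{.\,.} e_r] \times (b_c \mathinner{.\,.} e_c]} T[i,j]$; an all-zero query, with the same arguments, returns $1$ iff $T[i,j]=0$ for all $(i,j) \in (b_r \mathinner{.\,.} e_r] \times (b_c \mathinner{.\,.} e_c]$; a square all-zero query, given $\ell \ge 0$, $e_r \in [0 \mathinner{.\,.} r]$, $e_c \in [0 \mathinner{.\,.} c]$ with $e_r,e_c \ge \ell$, returns the all-zero query on $(e_r-\ell \mathinner{.\,.} e_r] \times (e_c-\ell \mathinner{.\,.} e_c]$; an equality query, given $b_r,b_r',h \in [1 \mathinner{.\,.} r]$ and $b_c,b_c',w \in [1 \mathinner{.\,.} c]$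 with $\max(b_r,b_r')+h \le r+1$ and $\max(b_c,b_c')+w \le c+1$, returns $1$ iff $T[b_r \mathinner{.\,.} b_r+h)[b_c \mathinner{.\,.} b_c+w) = T[b_r' \mathinner{.\,.} b_r'+h)[b_c' \mathinner{.\,.} b_c'+w)$; a square LCE query, given $b_r,b_r' \in [1 \mathinner{.\,.} r]$, $b_c,b_c' \in [1 \mathinner{.\,.} c]$, returns the largest $t \ge 0$ with $T[b_r \mathinner{.\,.} b_r+t)[b_c \mathinner{.\,.} b_c+t) = T[b_r' \mathinner{.\,.} b_r'+t)[b_c' \mathinner{.\,.} b_c'+t)$; a line LCE query, given additionally $\ell$ with $b_r+\ell \le r+1$ and $b_r'+\ell \le r+1$, returns the largest $t \ge 0$ with $T[b_r \mathinner{.\,.} b_r+\ell)[b_c \mathinner{.\,.} b_c+t) = T[b_r' \mathinner{.\,.} b_r'+\ell)[b_c' \mathinner{.\,.} b_c'+t)$. For a string $T \in \Sigma^{n}$, a symbol occurrence query, given $b,e \in [0 \mathinner{.\,.} n]$ and $c \in \Sigma$, returns $1$ if there exists $j \in (b \mathinner{.\,.} e]$ with $T[j]=c$, and $0$ otherwise. *)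

theory Defs
  imports Complex_Main "Jordan_Normal_Form.Matrix"
begin

unbundle bit_operations_syntax

section \<open>Straight-line grammars\<close>

text \<open>Every nonterminal has exactly one rule, so the rule set is given by a function from
  nonterminals to right-hand sides; its values outside the nonterminal set are irrelevant.\<close>

datatype ('n, 'a) rhs = Lit 'a | Bin 'n 'n

fun rhs_length :: "('n, 'a) rhs \<Rightarrow> nat" where
  "rhs_length (Lit a) = 1"
| "rhs_length (Bin A B) = 2"

fun rhs_nonterms :: "('n, 'a) rhs \<Rightarrow> 'n set" where
  "rhs_nonterms (Lit a) = {}"
| "rhs_nonterms (Bin A B) = {A, B}"

definition occurs_in_rule :: "'n set \<Rightarrow> ('n \<Rightarrow> ('n, 'a) rhs) \<Rightarrow> ('n \<times> 'n) set" where
  "occurs_in_rule V R = {(A, N). N \<in> V \<and> A \<in> rhs_nonterms (R N)}"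

definition rules_size :: "'n set \<Rightarrow> ('n \<Rightarrow> ('n, 'a) rhs) \<Rightarrow> nat" where
  "rules_size V R = (\<Sum>N\<in>V. max (rhs_length (R N)) 1)"

subsection \<open>1D SLPs\<close>

record ('n, 'a) slp1 =
  nonterms1 :: "'n set"
  alphabet1 :: "'a set"
  rule1 :: "'n \<Rightarrow> ('n, 'a) rhs"
  start1 :: 'n

definition is_slp1 :: "('n, 'a) slp1 \<Rightarrow> bool" where
  "is_slp1 G \<longleftrightarrow>
     finite (nonterms1 G) \<and> finite (alphabet1 G) \<and> start1 G \<in> nonterms1 G \<and>
     (\<forall>N\<in>nonterms1 G. (\<exists>a\<in>alphabet1 G. rule1 G N = Lit a) \<or>
        (\<exists>A\<in>nonterms1 G. \<exists>B\<in>nonterms1 G. rule1 G N = Bin A B)) \<and>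
     acyclic (occurs_in_rule (nonterms1 G) (rule1 G))"

inductive expands1 :: "('n, 'a) slp1 \<Rightarrow> 'n \<Rightarrow> 'a list \<Rightarrow> bool" for G where
  "N \<in> nonterms1 G \<Longrightarrow> rule1 G N = Lit a \<Longrightarrow> expands1 G N [a]"
| "N \<in> nonterms1 G \<Longrightarrow> rule1 G N = Bin A B \<Longrightarrow> expands1 G A X \<Longrightarrow> expands1 G B Y \<Longrightarrow>
     expands1 G N (X @ Y)"

definition represents1 :: "('n, 'a) slp1 \<Rightarrow> 'a list \<Rightarrow> bool" where
  "represents1 G T \<longleftrightarrow> expands1 G (start1 G) T"

definition size1 :: "('n, 'a) slp1 \<Rightarrow> nat" where
  "size1 G = rules_size (nonterms1 G) (rule1 G)"

subsection \<open>2D SLPs\<close>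

record ('n, 'a) slp2 =
  lit_nonterms :: "'n set"
  hor_nonterms :: "'n set"
  ver_nonterms :: "'n set"
  alphabet2 :: "'a set"
  rule2 :: "'n \<Rightarrow> ('n, 'a) rhs"
  start2 :: 'n

definition nonterms2 :: "('n, 'a) slp2 \<Rightarrow> 'n set" where
  "nonterms2 G = lit_nonterms G \<union> hor_nonterms G \<union> ver_nonterms G"

definition on_top_of :: "'a mat \<Rightarrow> 'a mat \<Rightarrow> 'a mat" where
  "on_top_of X Y = mat (dim_row X + dim_row Y) (dim_col X)
     (\<lambda>(i, j). if i < dim_row X then X $$ (i, j) else Y $$ (i - dim_row X, j))"

definition left_of :: "'a mat \<Rightarrow> 'a mat \<Rightarrow> 'a mat" where
  "left_of X Y = mat (dim_row X) (dim_col X + dim_col Y)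
     (\<lambda>(i, j). if j < dim_col X then X $$ (i, j) else Y $$ (i, j - dim_col X))"

inductive expands2 :: "('n, 'a) slp2 \<Rightarrow> 'n \<Rightarrow> 'a mat \<Rightarrow> bool" for G where
  "N \<in> lit_nonterms G \<Longrightarrow> rule2 G N = Lit a \<Longrightarrow> expands2 G N (mat 1 1 (\<lambda>_. a))"
| "N \<in> hor_nonterms G \<Longrightarrow> rule2 G N = Bin A B \<Longrightarrow> expands2 G A X \<Longrightarrow> expands2 G B Y \<Longrightarrow>
     expands2 G N (on_top_of X Y)"
| "N \<in> ver_nonterms G \<Longrightarrow> rule2 G N = Bin A B \<Longrightarrow> expands2 G A X \<Longrightarrow> expands2 G B Y \<Longrightarrow>
     expands2 G N (left_of X Y)"

definition is_slp2 :: "('n, 'a) slp2 \<Rightarrow> bool" where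
  "is_slp2 G \<longleftrightarrow>
     finite (nonterms2 G) \<and> finite (alphabet2 G) \<and> start2 G \<in> nonterms2 G \<and>
     lit_nonterms G \<inter> hor_nonterms G = {} \<and>
     lit_nonterms G \<inter> ver_nonterms G = {} \<and>
     hor_nonterms G \<inter> ver_nonterms G = {} \<and>
     (\<forall>N\<in>lit_nonterms G. \<exists>a\<in>alphabet2 G. rule2 G N = Lit a) \<and>
     (\<forall>N\<in>hor_nonterms G \<union> ver_nonterms G.
        \<exists>A\<in>nonterms2 G. \<exists>B\<in>nonterms2 G. rule2 G N = Bin A B) \<and>
     acyclic (occurs_in_rule (nonterms2 G) (rule2 G)) \<and>
     (\<forall>N\<in>hor_nonterms G. \<forall>A B X Y. rule2 G N = Bin A B \<longrightarrow>
        expands2 G A X \<longrightarrow> expands2 G B Y \<longrightarrow> dim_col X = dim_col Y) \<and>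
     (\<forall>N\<in>ver_nonterms G. \<forall>A B X Y. rule2 G N = Bin A B \<longrightarrow>
        expands2 G A X \<longrightarrow> expands2 G B Y \<longrightarrow> dim_row X = dim_row Y)"

definition represents2 :: "('n, 'a) slp2 \<Rightarrow> 'a mat \<Rightarrow> bool" where
  "represents2 G T \<longleftrightarrow> expands2 G (start2 G) T"

definition size2 :: "('n, 'a) slp2 \<Rightarrow> nat" where
  "size2 G = rules_size (nonterms2 G) (rule2 G)"

section \<open>Queries\<close>

text \<open>A query problem on a given input is the set of all pairs of an admissible argument list
  and the corresponding answer. Boolean answers are coded as 0 and 1. Positions are 1-based,
  whereas the entries of a \<^typ>\<open>'a mat\<close> and of a list are 0-based.\<close>

type_synonym query_problem = "(nat list \<times> nat) set"

definition entry :: "'a mat \<Rightarrow> nat \<Rightarrow> nat \<Rightarrow> 'a" where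
  "entry T i j = T $$ (i - 1, j - 1)"

text \<open>\<open>block T b\<^sub>r h b\<^sub>c w\<close> is $T[b_r .. b_r+h)[b_c .. b_c+w)$.\<close>

definition block :: "'a mat \<Rightarrow> nat \<Rightarrow> nat \<Rightarrow> nat \<Rightarrow> nat \<Rightarrow> 'a mat" where
  "block T br h bc w = mat h w (\<lambda>(i, j). entry T (br + i) (bc + j))"

definition all_zero :: "nat mat \<Rightarrow> nat \<Rightarrow> nat \<Rightarrow> nat \<Rightarrow> nat \<Rightarrow> bool" where
  "all_zero T br er bc ec \<longleftrightarrow> (\<forall>(i, j) \<in> {br<..er} \<times> {bc<..ec}. entry T i j = 0)"

definition sum_queries :: "nat mat \<Rightarrow> query_problem" where
  "sum_queries T =
     {([br, er, bc, ec], \<Sum>(i, j) \<in> {br<..er} \<times> {bc<..ec}. entry T i j) | br er bc ec.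
        br \<le> dim_row T \<and> er \<le> dim_row T \<and> bc \<le> dim_col T \<and> ec \<le> dim_col T}"

definition all_zero_queries :: "nat mat \<Rightarrow> query_problem" where
  "all_zero_queries T =
     {([br, er, bc, ec], of_bool (all_zero T br er bc ec)) | br er bc ec.
        br \<le> dim_row T \<and> er \<le> dim_row T \<and> bc \<le> dim_col T \<and> ec \<le> dim_col T}"

definition square_all_zero_queries :: "nat mat \<Rightarrow> query_problem" where
  "square_all_zero_queries T =
     {([l, er, ec], of_bool (all_zero T (er - l) er (ec - l) ec)) | l er ec.
        er \<le> dim_row T \<and> ec \<le> dim_col T \<and> l \<le> er \<and> l \<le> ec}"

definition equality_queries :: "nat mat \<Rightarrow> query_problem" where
  "equality_queries T =
     {([br, br', h, bc, bc', w], of_bool (block T br h bc w = block T br' h bc' w))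
      | br br' h bc bc' w.
        br \<in> {1..dim_row T} \<and> br' \<in> {1..dim_row T} \<and> h \<in> {1..dim_row T} \<and>
        bc \<in> {1..dim_col T} \<and> bc' \<in> {1..dim_col T} \<and> w \<in> {1..dim_col T} \<and>
        max br br' + h \<le> dim_row T + 1 \<and> max bc bc' + w \<le> dim_col T + 1}"

text \<open>In the LCE queries, \<open>t\<close> ranges over the values for which both blocks lie inside \<open>T\<close>.\<close>

definition square_lce :: "nat mat \<Rightarrow> nat \<Rightarrow> nat \<Rightarrow> nat \<Rightarrow> nat \<Rightarrow> nat" where
  "square_lce T br br' bc bc' =
     Max {t. max br br' + t \<le> dim_row T + 1 \<and> max bc bc' + t \<le> dim_col T + 1 \<and>
             block T br t bc t = block T br' t bc' t}"

definition square_lce_queries :: "nat mat \<Rightarrow> query_problem" where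
  "square_lce_queries T =
     {([br, br', bc, bc'], square_lce T br br' bc bc') | br br' bc bc'.
        br \<in> {1..dim_row T} \<and> br' \<in> {1..dim_row T} \<and>
        bc \<in> {1..dim_col T} \<and> bc' \<in> {1..dim_col T}}"

definition line_lce :: "nat mat \<Rightarrow> nat \<Rightarrow> nat \<Rightarrow> nat \<Rightarrow> nat \<Rightarrow> nat \<Rightarrow> nat" where
  "line_lce T br br' bc bc' l =
     Max {t. max bc bc' + t \<le> dim_col T + 1 \<and> block T br l bc t = block T br' l bc' t}"

definition line_lce_queries :: "nat mat \<Rightarrow> query_problem" where
  "line_lce_queries T =
     {([br, br', bc, bc', l], line_lce T br br' bc bc' l) | br br' bc bc' l.
        br \<in> {1..dim_row T} \<and> br' \<in> {1..dim_row T} \<and>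
        bc \<in> {1..dim_col T} \<and> bc' \<in> {1..dim_col T} \<and>
        br + l \<le> dim_row T + 1 \<and> br' + l \<le> dim_row T + 1}"

definition symbol_occurrence_queries :: "nat set \<Rightarrow> nat list \<Rightarrow> query_problem" where
  "symbol_occurrence_queries \<Sigma> T =
     {([b, e, c], of_bool (\<exists>j\<in>{b<..e}. T ! (j - 1) = c)) | b e c.
        b \<le> length T \<and> e \<le> length T \<and> c \<in> \<Sigma>}"

section \<open>Word RAM\<close>

text \<open>Registers and memory cells hold \<open>w\<close>-bit words; every instruction takes unit time.
  A program accesses only the finitely many registers it mentions, and addresses, being words,
  reach \<open>2 ^ w\<close> memory cells.\<close>

datatype binop = Add | Sub | Mul | Div | Mod | And | Or | Xor | Shl | Shr | Eq | Less

fun eval_binop :: "nat \<Rightarrow> binop \<Rightarrow> nat \<Rightarrow> nat \<Rightarrow> nat" where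
  "eval_binop w Add x y = (x + y) mod 2 ^ w"
| "eval_binop w Sub x y = (x + 2 ^ w - y) mod 2 ^ w"
| "eval_binop w Mul x y = (x * y) mod 2 ^ w"
| "eval_binop w Div x y = x div y"
| "eval_binop w Mod x y = x mod y"
| "eval_binop w And x y = x AND y"
| "eval_binop w Or x y = x OR y"
| "eval_binop w Xor x y = x XOR y"
| "eval_binop w Shl x y = push_bit y x mod 2 ^ w"
| "eval_binop w Shr x y = drop_bit y x"
| "eval_binop w Eq x y = of_bool (x = y) mod 2 ^ w"
| "eval_binop w Less x y = of_bool (x < y) mod 2 ^ w"

datatype instr =
    Const nat nat           \<comment> \<open>\<open>r := constant\<close>\<close>
  | Op binop nat nat nat    \<comment> \<open>\<open>r := r' op r''\<close>\<close>
  | Load nat nat            \<comment> \<open>\<open>r := mem[r']\<close>\<close>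
  | Store nat nat           \<comment> \<open>\<open>mem[r] := r'\<close>\<close>
  | Jump nat
  | JumpZero nat nat        \<comment> \<open>if register \<open>r\<close> is 0, go to the given instruction\<close>

record config =
  pc :: nat
  regs :: "nat \<Rightarrow> nat"
  mem :: "nat \<Rightarrow> nat"

fun exec_instr :: "nat \<Rightarrow> instr \<Rightarrow> config \<Rightarrow> config" where
  "exec_instr w (Const r v) s = s\<lparr>pc := pc s + 1, regs := (regs s)(r := v mod 2 ^ w)\<rparr>"
| "exec_instr w (Op f r r' r'') s =
     s\<lparr>pc := pc s + 1, regs := (regs s)(r := eval_binop w f (regs s r') (regs s r''))\<rparr>"
| "exec_instr w (Load r r') s = s\<lparr>pc := pc s + 1, regs := (regs s)(r := mem s (regs s r'))\<rparr>"
| "exec_instr w (Store r r') s = s\<lparr>pc := pc s + 1, mem := (mem s)(regs s r := regs s r')\<rparr>"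
| "exec_instr w (Jump l) s = s\<lparr>pc := l\<rparr>"
| "exec_instr w (JumpZero r l) s = s\<lparr>pc := (if regs s r = 0 then l else pc s + 1)\<rparr>"

text \<open>A program halts when the program counter leaves it.\<close>

definition halted :: "instr list \<Rightarrow> config \<Rightarrow> bool" where
  "halted P s \<longleftrightarrow> length P \<le> pc s"

definition step :: "nat \<Rightarrow> instr list \<Rightarrow> config \<Rightarrow> config" where
  "step w P s = (if halted P s then s else exec_instr w (P ! pc s) s)"

text \<open>Initially the data structure \<open>D\<close> occupies the first cells of memory, the query arguments
  are in the first registers, and everything else is 0.\<close>

definition initial_config :: "nat list \<Rightarrow> nat list \<Rightarrow> config" where
  "initial_config D args =
     \<lparr>pc = 0,
      regs = (\<lambda>i. if i < length args then args ! i else 0),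
      mem = (\<lambda>i. if i < length D then D ! i else 0)\<rparr>"

text \<open>With word size \<open>w\<close>, program \<open>P\<close> run on the data structure \<open>D\<close> answers every query of \<open>Q\<close>
  in at most \<open>\<tau>\<close> steps, leaving the answer in register 0. In particular all cells of \<open>D\<close> and all
  query arguments must be \<open>w\<close>-bit words.\<close>

definition answers_queries ::
  "nat \<Rightarrow> instr list \<Rightarrow> nat list \<Rightarrow> real \<Rightarrow> query_problem \<Rightarrow> bool" where
  "answers_queries w P D \<tau> Q \<longleftrightarrow>
     (\<forall>x\<in>set D. x < 2 ^ w) \<and>
     (\<forall>(args, ans)\<in>Q. (\<forall>x\<in>set args. x < 2 ^ w) \<and>
        (\<exists>t. real t \<le> \<tau> \<and>
           (let s = (step w P ^^ t) (initial_config D args) in halted P s \<and> regs s 0 = ans)))"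

section \<open>Data structures for SLP-compressed inputs\<close>

text \<open>Binary logarithm, shifted so that it is at least 1 (not 0) for inputs of length 1.\<close>

definition lg :: "nat \<Rightarrow> real" where
  "lg n = log 2 (real n + 1)"

text \<open>The query algorithm \<open>P\<close> and the constants hidden in the O-notation do not depend on the
  grammar. The word size is any \<open>w = \<Omega>(log n)\<close>. Size is measured in words.\<close>

definition has_slp2_data_structure :: "(nat mat \<Rightarrow> query_problem) \<Rightarrow> bool" where
  "has_slp2_data_structure Q \<longleftrightarrow>
     (\<exists>P (\<kappa>::nat) (C\<^sub>s::nat) (k\<^sub>s::nat) (C\<^sub>t::nat) (k\<^sub>t::nat).
        \<forall>(G :: (nat, nat) slp2) T n w.
          is_slp2 G \<and> alphabet2 G = {0, 1} \<and> represents2 G T \<and>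
          n = max (dim_row T) (dim_col T) \<and> real w \<ge> real \<kappa> * lg n \<longrightarrow>
          (\<exists>D. real (length D) \<le> real C\<^sub>s * real (size2 G) * lg n ^ k\<^sub>s \<and>
               answers_queries w P D (real C\<^sub>t * lg n ^ k\<^sub>t) (Q T)))"

text \<open>The alphabet is \<open>[0..\<sigma>)\<close> with \<open>\<sigma>\<close> polynomial in \<open>n\<close>, i.e. \<open>\<sigma> \<le> A * n ^ d\<close> for arbitrary constants
  \<open>A\<close> and \<open>d\<close>, on which the other constants may depend.\<close>

definition has_slp1_data_structure :: "(nat set \<Rightarrow> nat list \<Rightarrow> query_problem) \<Rightarrow> bool" where
  "has_slp1_data_structure Q \<longleftrightarrow>
     (\<forall>(A::nat) (d::nat).
      \<exists>P (\<kappa>::nat) (C\<^sub>s::nat) (k\<^sub>s::nat) (C\<^sub>t::nat) (k\<^sub>t::nat).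
        \<forall>(G :: (nat, nat) slp1) T n \<sigma> w.
          is_slp1 G \<and> alphabet1 G = {0..<\<sigma>} \<and> represents1 G T \<and>
          n = length T \<and> \<sigma> \<le> A * n ^ d \<and> real w \<ge> real \<kappa> * lg n \<longrightarrow>
          (\<exists>D. real (length D) \<le> real C\<^sub>s * real (size1 G) * lg n ^ k\<^sub>s \<and>
               answers_queries w P D (real C\<^sub>t * lg n ^ k\<^sub>t) (Q {0..<\<sigma>} T)))"

end

theory Submission
  imports Defs
begin

text \<open>
  For a string \<open>T\<close> of length \<open>n\<close> over \<open>[0..\<sigma>)\<close>, consider the 0/1 matrix with \<open>n\<close> columns and
  \<open>(\<sigma> + 1) * n + 1\<close> rows whose column \<open>j\<close> has its only 1 in row \<open>(T[j] + 1) * n\<close> (0-based). It has a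
  2D SLP that is larger than the 1D SLP of \<open>T\<close> only by a logarithmic factor: the columns of single
  letters consist of long runs of zeros, obtained by repeated halving, and concatenation of strings
  is juxtaposition of matrices. The symbol \<open>c\<close> occurs in \<open>T(b..e]\<close> iff row \<open>(c + 1) * n\<close> is not zero
  in the columns \<open>(b..e]\<close>. The \<open>n - 1\<close> rows below that row and the first \<open>n\<close> rows are zero, so the
  row may be extended to a square, and it may be compared with the first row; hence each of the six
  query types decides this with a single query.

  To form that query, the algorithm needs \<open>n\<close>, which is stored in memory cell 0; the given query
  algorithm is run with all addresses shifted by one. The shift is modulo the number of memory cells,
  so the given data structure must leave one cell unused. This is ensured by discarding useless
  nonterminals of the 1D SLP, which makes its size linear in \<open>n\<close>.
\<close>

section \<open>Word RAM programs\<close>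

fun straight :: "instr \<Rightarrow> bool" where
  "straight (Jump l) = False"
| "straight (JumpZero r l) = False"
| "straight _ = True"

lemma straight_pc: "straight i \<Longrightarrow> pc (exec_instr w i s) = Suc (pc s)"
  by (cases i) auto

text \<open>Moving the executed instruction from \<open>Q\<close> to the prefix \<open>P1\<close>
  makes the induction go through for arbitrary surrounding code. This lets the pieces placed around
  the given query algorithm be evaluated as a plain \<open>fold\<close>.\<close>

lemma run_straight_line:
  assumes "\<forall>i\<in>set Q. straight i" "pc s = length P1"
  shows "(step w (P1 @ Q @ P2) ^^ length Q) s = fold (exec_instr w) Q s"
    and "pc (fold (exec_instr w) Q s) = length P1 + length Q"
  using assms
proof (induction Q arbitrary: P1 s)
  case Nil
  { case 1 show ?case by simp }
  { case 2 then show ?case by simp }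
next
  case (Cons i Q)
  have first: "step w (P1 @ (i # Q) @ P2) s = exec_instr w i s"
    if "pc s = length P1" for s P1
    using that by (simp add: step_def halted_def nth_append)
  { case 1
    have "(step w ((P1 @ [i]) @ Q @ P2) ^^ length Q) (exec_instr w i s)
        = fold (exec_instr w) Q (exec_instr w i s)"
      using 1 Cons.IH(1)[of "exec_instr w i s" "P1 @ [i]"] by (simp add: straight_pc)
    then show ?case
      using 1 first[of s] by (simp add: funpow_Suc_right del: funpow.simps) }
  { case 2
    then show ?case
      using Cons.IH(2)[of "exec_instr w i s" "P1 @ [i]"] by (simp add: straight_pc) }
qed

fun instr_regs :: "instr \<Rightarrow> nat set" where
  "instr_regs (Const r v) = {r}"
| "instr_regs (Op f r r' r'') = {r, r', r''}"
| "instr_regs (Load r r') = {r, r'}"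
| "instr_regs (Store r r') = {r, r'}"
| "instr_regs (Jump l) = {}"
| "instr_regs (JumpZero r l) = {r}"

lemma finite_instr_regs: "finite (instr_regs i)"
  by (cases i) auto

text \<open>Supplies the base \<open>F\<close> of the fresh registers: a program mentions finitely
  many registers, so everything from \<open>F\<close> on stays untouched while it runs.\<close>

lemma register_bound_exists:
  "\<exists>F\<ge>k. \<forall>i\<in>set P. \<forall>r\<in>instr_regs i. r < F" for k :: nat
proof -
  have "finite (\<Union>i\<in>set P. instr_regs i)"
    by (rule finite_UN_I) (auto intro: finite_instr_regs)
  then obtain m where "\<forall>r\<in>(\<Union>i\<in>set P. instr_regs i). r < m"
    by (meson finite_nat_set_iff_bounded)
  then show ?thesis
    by (intro exI[of _ "max k m"]) (auto simp: less_max_iff_disj)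
qed

section \<open>Running a program with all memory addresses shifted by one\<close>

definition word_config :: "nat \<Rightarrow> config \<Rightarrow> bool" where
  "word_config w s \<longleftrightarrow> (\<forall>r. regs s r < 2 ^ w) \<and> (\<forall>a. mem s a < 2 ^ w)"

lemma eval_binop_less:
  assumes "x < 2 ^ w" "y < 2 ^ w"
  shows "eval_binop w f x y < 2 ^ w"
proof -
  have tb: "z < 2 ^ w \<longleftrightarrow> take_bit w z = z" for z :: nat
    by (simp add: take_bit_nat_eq_self_iff)
  have "x AND y < 2 ^ w" "x OR y < 2 ^ w" "x XOR y < 2 ^ w"
    using assms unfolding tb by simp_all
  moreover have "drop_bit y x \<le> x"
    by (simp add: drop_bit_eq_div)
  ultimately show ?thesis
    using assms
    by (cases f) (auto intro: le_less_trans[OF _ assms(1)] div_le_dividend mod_less_eq_dividend)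
qed

lemma word_config_step: "word_config w s \<Longrightarrow> word_config w (step w P s)"
  by (cases "P ! pc s") (auto simp: word_config_def step_def eval_binop_less)

text \<open>Every instruction becomes exactly two, padded by a write to the scratch register
  \<open>F + 11\<close> where necessary, so instruction \<open>i\<close> starts at
  \<open>B + 2 * i\<close> and jump targets can be computed. Register \<open>F\<close> is meant to
  hold 1. Clipping targets at the program length \<open>m\<close> sends every halting jump to the
  first instruction behind the shifted code.\<close>

fun shift_instr :: "nat \<Rightarrow> nat \<Rightarrow> nat \<Rightarrow> instr \<Rightarrow> instr list" where
  "shift_instr F B m (Load r r') = [Op Add (F + 11) r' F, Load r (F + 11)]"
| "shift_instr F B m (Store r r') = [Op Add (F + 11) r F, Store (F + 11) r']"
| "shift_instr F B m (Jump l) = [Const (F + 11) 0, Jump (B + 2 * min l m)]"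
| "shift_instr F B m (JumpZero r l) = [Const (F + 11) 0, JumpZero r (B + 2 * min l m)]"
| "shift_instr F B m i = [Const (F + 11) 0, i]"

lemma length_shift_instr: "length (shift_instr F B m i) = 2"
  by (cases i) auto

definition shift_program :: "nat \<Rightarrow> nat \<Rightarrow> instr list \<Rightarrow> instr list" where
  "shift_program F B P = concat (map (shift_instr F B (length P)) P)"

lemma length_concat_pairs:
  "(\<And>x. length (f x) = 2) \<Longrightarrow> length (concat (map f xs)) = 2 * length xs"
  by (induction xs) auto

lemma nth_concat_pairs:
  assumes "\<And>x. length (f x) = 2" "i < length xs" "j < 2"
  shows "concat (map f xs) ! (2 * i + j) = f (xs ! i) ! j"
  using assms(2)
proof (induction xs arbitrary: i)
  case (Cons x xs)
  then show ?case
    using assms(1,3) by (cases i) (auto simp: nth_append)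
qed simp

lemma length_shift_program: "length (shift_program F B P) = 2 * length P"
  by (simp add: shift_program_def length_concat_pairs length_shift_instr)

lemma nth_shift_program:
  assumes "i < length P" "length pre = B"
  shows "(pre @ shift_program F B P @ post) ! (B + 2 * i) = shift_instr F B (length P) (P ! i) ! 0"
    and "(pre @ shift_program F B P @ post) ! Suc (B + 2 * i) = shift_instr F B (length P) (P ! i) ! 1"
proof -
  have 2: "(pre @ shift_program F B P @ post) ! (B + 2 * i + j) = shift_instr F B (length P) (P ! i) ! j"
    if "j < 2" for j
  proof -
    have "2 * i + j < length (shift_program F B P)"
      using assms that by (simp add: length_shift_program)
    then have "(pre @ shift_program F B P @ post) ! (B + 2 * i + j) = shift_program F B P ! (2 * i + j)"
      using assms by (simp add: nth_append add.assoc)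
    then show ?thesis
      using nth_concat_pairs[OF length_shift_instr, of i P j] assms that
      by (simp add: shift_program_def)
  qed
  show "(pre @ shift_program F B P @ post) ! (B + 2 * i) = shift_instr F B (length P) (P ! i) ! 0"
    using 2[of 0] by simp
  show "(pre @ shift_program F B P @ post) ! Suc (B + 2 * i) = shift_instr F B (length P) (P ! i) ! 1"
    using 2[of 1] by simp
qed

text \<open>\<open>K\<close> freezes the contents of the registers from \<open>F\<close> on, apart
  from the scratch register, so that values prepared before the run are still available after
  it.\<close>

definition simulates :: "nat \<Rightarrow> nat \<Rightarrow> nat \<Rightarrow> instr list \<Rightarrow> (nat \<Rightarrow> nat) \<Rightarrow> config \<Rightarrow> config \<Rightarrow> bool" where
  "simulates w F B P K s s' \<longleftrightarrow>
     word_config w s \<and> pc s' = B + 2 * min (pc s) (length P) \<and>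
     (\<forall>r<F. regs s' r = regs s r) \<and>
     (\<forall>r\<ge>F. r \<noteq> F + 11 \<longrightarrow> regs s' r = K r) \<and>
     (\<forall>a<2 ^ w. mem s' ((a + 1) mod 2 ^ w) = mem s a)"

text \<open>The cyclic shift permutes the addresses, hence a shifted store changes no cell other
  than the intended one.\<close>

lemma shift_address_inj:
  assumes "a < m" "b < m" "(a + 1) mod m = (b + 1) mod m"
  shows "a = (b::nat)"
proof -
  have "(x + 1) mod m = (if x + 1 = m then 0 else x + 1)" if "x < m" for x
    using that by auto
  then show ?thesis
    using assms by (auto split: if_splits)
qed

lemma simulates_step:
  assumes sim: "simulates w F B P K s s'" and "\<not> halted P s" and "K F = 1"
    and regs: "\<forall>i\<in>set P. \<forall>r\<in>instr_regs i. r < F"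
    and B: "length pre = B"
  shows "simulates w F B P K (step w P s) ((step w (pre @ shift_program F B P @ post) ^^ 2) s')"
proof -
  let ?P' = "pre @ shift_program F B P @ post"
  define p where "p = pc s"
  have p: "p < length P"
    using assms(2) by (simp add: halted_def p_def)
  have pc': "pc s' = B + 2 * p"
    using sim p by (simp add: simulates_def p_def)
  have len: "length ?P' \<ge> B + 2 * p + 2"
    using p B by (simp add: length_shift_program)
  obtain i1 i2 where i12: "shift_instr F B (length P) (P ! p) = [i1, i2]"
    by (cases "P ! p") auto
  obtain I where I: "P ! p = I"
    by blast
  have s1: "step w ?P' s' = exec_instr w i1 s'"
    using nth_shift_program(1)[OF p B, of F post] len pc' i12
    by (simp add: step_def halted_def)
  have "straight i1"
    using i12 by (cases "P ! p") auto
  then have pc1: "pc (exec_instr w i1 s') = Suc (B + 2 * p)"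
    using pc' by (simp add: straight_pc)
  then have "step w ?P' (exec_instr w i1 s') = exec_instr w i2 (exec_instr w i1 s')"
    using nth_shift_program(2)[OF p B, of F post] len i12
    by (simp add: step_def halted_def)
  then have s2: "(step w ?P' ^^ 2) s' = exec_instr w i2 (exec_instr w i1 s')"
    using s1 by (simp add: numeral_2_eq_2)
  have s: "step w P s = exec_instr w (P ! p) s"
    using assms(2) by (simp add: step_def p_def)
  have wc: "word_config w (step w P s)"
    using sim word_config_step by (simp add: simulates_def)
  have r: "\<forall>r\<in>instr_regs (P ! p). r < F"
    using regs p by auto
  have w: "regs s r < 2 ^ w" for r
    using sim by (simp add: simulates_def word_config_def)
  have eq: "regs s' r = regs s r" if "r < F" for r
    using sim that by (simp add: simulates_def)
  have one: "regs s' F = 1"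
    using sim \<open>K F = 1\<close> by (simp add: simulates_def)
  have m: "mem s' ((a + 1) mod 2 ^ w) = mem s a" if "a < 2 ^ w" for a
    using sim that by (simp add: simulates_def)
  note i12 = i12[unfolded I] and s = s[unfolded I] and r = r[unfolded I]
  show ?thesis
    unfolding simulates_def s2
  proof (intro conjI wc)
    show "pc (exec_instr w i2 (exec_instr w i1 s')) = B + 2 * min (pc (step w P s)) (length P)"
      unfolding s using i12 r p pc' eq by (cases I) (auto simp: p_def[symmetric])
    show "\<forall>ra<F. regs (exec_instr w i2 (exec_instr w i1 s')) ra = regs (step w P s) ra"
      unfolding s using i12 r eq m[simplified] w one by (cases I) auto
    show "\<forall>ra\<ge>F. ra \<noteq> F + 11 \<longrightarrow> regs (exec_instr w i2 (exec_instr w i1 s')) ra = K ra"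
      using i12 r sim unfolding simulates_def by (cases I) auto
    show "\<forall>a<2 ^ w. mem (exec_instr w i2 (exec_instr w i1 s')) ((a + 1) mod 2 ^ w) = mem (step w P s) a"
    \<comment> \<open>Only a store changes memory. The written address is a word, so injectivity of
      the shift separates it from all other cells.\<close>
    proof (cases I)
      case (Store x y)
      have "x < F" "y < F"
        using Store r by auto
      then show ?thesis
        unfolding s using Store i12 m eq one w[of x] shift_address_inj[of _ "2 ^ w" "regs s x"]
        by (auto simp del: One_nat_def)
    qed (use i12 m in \<open>auto simp: s\<close>)
  qed
qed

text \<open>Each live step costs two steps. After the original program halts, the simulation must
  stop advancing, since the shifted program would run on into the code behind it; therefore
  \<open>t'\<close> is only bounded by \<open>2 * t\<close>.\<close>

lemma simulates_run:
  assumes "simulates w F B P K s s'" and "K F = 1"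
    and "\<forall>i\<in>set P. \<forall>r\<in>instr_regs i. r < F" and "length pre = B"
  shows "\<exists>t'\<le>2 * t. simulates w F B P K ((step w P ^^ t) s)
     ((step w (pre @ shift_program F B P @ post) ^^ t') s')"
proof (induction t)
  case 0
  then show ?case using assms by auto
next
  case (Suc t)
  then obtain t' where t': "t' \<le> 2 * t"
    "simulates w F B P K ((step w P ^^ t) s) ((step w (pre @ shift_program F B P @ post) ^^ t') s')"
    by blast
  show ?case
  proof (cases "halted P ((step w P ^^ t) s)")
    case True
    then have "(step w P ^^ Suc t) s = (step w P ^^ t) s"
      by (simp add: step_def)
    then show ?thesis
      using t' by (metis mult_le_mono2 order_trans le_SucI order_refl)
  next
    case False
    then show ?thesis
      using t' simulates_step[OF t'(2) False assms(2-4), of post]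
      by (intro exI[of _ "Suc (Suc t')"]) (simp add: numeral_2_eq_2)
  qed
qed

text \<open>Register \<open>F + i\<close> holds the \<open>i\<close>-th of these values, from which the arguments of all six query
  types are chosen.\<close>

definition call_values :: "nat \<Rightarrow> nat \<Rightarrow> nat \<Rightarrow> nat \<Rightarrow> nat list" where
  "call_values n b e c =
     [1, 0, b, e, (c + 1) * n, (c + 1) * n + 1, b + 1, e - b, (c + 1) * n + (e - b)]"

text \<open>Registers \<open>0, 1, 2\<close> hold the query \<open>b, e, c\<close> and memory cell 0 holds \<open>n\<close>. If \<open>b \<ge> e\<close>,
  the interval is replaced by the dummy \<open>(0..1]\<close>, and the flag \<open>b < e\<close> kept in register \<open>F + 9\<close>
  later cancels the result.\<close>

definition prologue :: "nat \<Rightarrow> instr list" where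
  "prologue F =
     [Const F 1, Load (F + 10) (F + 1), Store (F + 1) (F + 1), Op Less (F + 9) 0 1,
      Op Mul (F + 2) 0 (F + 9), Op Eq (F + 11) (F + 9) (F + 1), Op Mul (F + 3) 1 (F + 9),
      Op Add (F + 3) (F + 3) (F + 11), Op Add (F + 4) 2 F, Op Mul (F + 4) (F + 4) (F + 10),
      Op Add (F + 5) (F + 4) F, Op Add (F + 6) (F + 2) F, Op Sub (F + 7) (F + 3) (F + 2),
      Op Add (F + 8) (F + 4) (F + 7)]"

text \<open>The hypothesis \<open>bound\<close> keeps all computed values below
  \<open>2 ^ w\<close>, so no operation overflows. Cell 0 is cleared after \<open>n\<close> has been
  read, because under the shift it plays the role of the last cell of the simulated memory, which
  must initially be 0.\<close>

lemma prologue_state: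
  fixes w F n b e c D
  defines "s0 \<equiv> initial_config (n # D) [b, e, c]"
  defines "s1 \<equiv> fold (exec_instr w) (prologue F) s0"
  assumes "F \<ge> 3" "1 \<le> n" "b \<le> n" "e \<le> n" and bound: "(c + 2) * n + 1 < 2 ^ w"
  shows "i < 9 \<Longrightarrow> regs s1 (F + i) = (if b < e then call_values n b e c else call_values n 0 1 c) ! i"
    and "regs s1 (F + 9) = of_bool (b < e)"
    and "3 \<le> r \<Longrightarrow> r < F \<Longrightarrow> regs s1 r = 0"
    and "mem s1 = (mem s0)(0 := 0)"
proof -
  \<comment> \<open>The interval actually queried: the given one, or the dummy (0..1].\<close>
  define b' e' where "b' = (if b < e then b else 0)" and "e' = (if b < e then e else 1)"
  define M where "M = (2::nat) ^ w"
  have bd: "(c + 1) * n + n + 1 < M"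
    using bound by (simp add: M_def algebra_simps)
  have "c + 1 \<le> (c + 1) * n"
    using mult_le_mono2[OF \<open>1 \<le> n\<close>, of "c + 1"] by simp
  then have c: "c + 1 < M" "(c + 1) * n < M" "(c + 1) * n + 1 < M"
      "(c + 1) * n + (e - b) < M" "(c + 1) * n + 1 < M" "n < M" "b < M" "e < M" "b + 1 < M" "1 < M"
    using bd assms(3-6) by linarith+
  have init: "regs s0 0 = b" "regs s0 1 = e" "regs s0 2 = c" "\<And>r. 3 \<le> r \<Longrightarrow> regs s0 r = 0" "mem s0 0 = n"
    by (auto simp: s0_def initial_config_def numeral_2_eq_2 numeral_3_eq_3)
  have F: "F \<noteq> 0" "F \<noteq> 1" "F \<noteq> 2" "\<And>k. F + k \<noteq> 0" "\<And>k. F + k \<noteq> 1" "\<And>k. F + k \<noteq> 2"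
     "3 \<le> F" "\<And>k. 3 \<le> F + k"
    using \<open>F \<ge> 3\<close> by auto
  have M: "x mod M = x" if "x < M" for x
    using that by simp
  have f: "(of_bool (b < e) :: nat) mod M = of_bool (b < e)"
    "(of_bool (of_bool (b < e) = (0::nat)) :: nat) mod M = of_bool (\<not> b < e)"
    using c(10) by (cases "b < e"; simp)+
  have be: "b' \<le> e'" "e' \<le> n" "b' \<le> n"
    using assms by (auto simp: b'_def e'_def)
  \<comment> \<open>Selection without branching: multiplying by the flag \<open>b < e\<close> keeps
    or erases \<open>b\<close> and \<open>e\<close>, and adding the negated flag turns an erased
    right end into 1.\<close>
  have p: "b * of_bool (b < e) mod M = b'"
    using c(7) by (cases "b < e") (simp_all add: b'_def)
  have p': "(e * of_bool (b < e) mod M + of_bool (\<not> b < e)) mod M = e'"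
    using c(8,10) by (cases "b < e") (simp_all add: e'_def)
  define c1 R l where "c1 = c + 1" and "R = c1 * n" and "l = e' - b'"
  have q: "(c + 1) mod M = c1" "(c1 * n) mod M = R" "(R + 1) mod M = R + 1"
    "(b' + 1) mod M = b' + 1" "(R + l) mod M = R + l" "1 mod M = 1"
    using be bd c unfolding c1_def R_def l_def by (intro M; linarith)+
  \<comment> \<open>Subtraction first adds \<open>M\<close> to avoid negative numbers; the final
    reduction removes it again because \<open>b' <= e'\<close>.\<close>
  have "e' + M - b' = l + M" "l < M"
    using be c unfolding l_def by linarith+
  then have q': "(e' + M - b') mod M = l"
    by (metis mod_add_self2 mod_less)
  note F' = F(1-3)[symmetric] F(4-6)[symmetric]
  define t0 where "t0 = s0"
  have r0: "regs t0 = regs s0" and m0: "mem t0 = mem s0" by (simp_all add: t0_def)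
  note ev = init F F' f p p' q q' M_def[symmetric]
  define t1 where "t1 = exec_instr w (Const F 1) t0"
  have r1: "regs t1 = (regs t0)(F := 1)" and m1: "mem t1 = mem t0"
    by (simp_all add: t1_def r0 m0 ev del: One_nat_def)
  define t2 where "t2 = exec_instr w (Load (F + 10) (F + 1)) t1"
  have r2: "regs t2 = (regs t1)(F + 10 := n)" and m2: "mem t2 = mem t1"
    by (simp_all add: t2_def r1 r0 m1 m0 ev del: One_nat_def)
  define t3 where "t3 = exec_instr w (Store (F + 1) (F + 1)) t2"
  have r3: "regs t3 = regs t2" and m3: "mem t3 = (mem t2)(0 := 0)"
    by (simp_all add: t3_def r2 r1 r0 m2 m1 m0 ev del: One_nat_def)
  define t4 where "t4 = exec_instr w (Op Less (F + 9) 0 1) t3"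
  have r4: "regs t4 = (regs t3)(F + 9 := of_bool (b < e))" and m4: "mem t4 = mem t3"
    by (simp_all add: t4_def r3 r2 r1 r0 ev del: One_nat_def)
  define t5 where "t5 = exec_instr w (Op Mul (F + 2) 0 (F + 9)) t4"
  have r5: "regs t5 = (regs t4)(F + 2 := b')" and m5: "mem t5 = mem t4"
    by (simp_all add: t5_def r4 r3 r2 r1 r0 ev del: One_nat_def)
  define t6 where "t6 = exec_instr w (Op Eq (F + 11) (F + 9) (F + 1)) t5"
  have r6: "regs t6 = (regs t5)(F + 11 := of_bool (\<not> b < e))" and m6: "mem t6 = mem t5"
    by (simp_all add: t6_def r5 r4 r3 r2 r1 r0 ev del: One_nat_def)
  define t7 where "t7 = exec_instr w (Op Mul (F + 3) 1 (F + 9)) t6"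
  have r7: "regs t7 = (regs t6)(F + 3 := e * of_bool (b < e) mod M)" and m7: "mem t7 = mem t6"
    by (simp_all add: t7_def r6 r5 r4 r3 r2 r1 r0 ev del: One_nat_def)
  define t8 where "t8 = exec_instr w (Op Add (F + 3) (F + 3) (F + 11)) t7"
  have r8: "regs t8 = (regs t7)(F + 3 := e')" and m8: "mem t8 = mem t7"
    by (simp_all add: t8_def r7 r6 r5 r4 r3 r2 r1 r0 ev del: One_nat_def)
  define t9 where "t9 = exec_instr w (Op Add (F + 4) 2 F) t8"
  have r9: "regs t9 = (regs t8)(F + 4 := c1)" and m9: "mem t9 = mem t8"
    by (simp_all add: t9_def r8 r7 r6 r5 r4 r3 r2 r1 r0 ev del: One_nat_def)
  define t10 where "t10 = exec_instr w (Op Mul (F + 4) (F + 4) (F + 10)) t9"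
  have r10: "regs t10 = (regs t9)(F + 4 := R)" and m10: "mem t10 = mem t9"
    by (simp_all add: t10_def r9 r8 r7 r6 r5 r4 r3 r2 r1 r0 ev del: One_nat_def)
  define t11 where "t11 = exec_instr w (Op Add (F + 5) (F + 4) F) t10"
  have r11: "regs t11 = (regs t10)(F + 5 := R + 1)" and m11: "mem t11 = mem t10"
    by (simp_all add: t11_def r10 r9 r8 r7 r6 r5 r4 r3 r2 r1 r0 ev del: One_nat_def)
  define t12 where "t12 = exec_instr w (Op Add (F + 6) (F + 2) F) t11"
  have r12: "regs t12 = (regs t11)(F + 6 := b' + 1)" and m12: "mem t12 = mem t11"
    by (simp_all add: t12_def r11 r10 r9 r8 r7 r6 r5 r4 r3 r2 r1 r0 ev del: One_nat_def)
  define t13 where "t13 = exec_instr w (Op Sub (F + 7) (F + 3) (F + 2)) t12"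
  have r13: "regs t13 = (regs t12)(F + 7 := l)" and m13: "mem t13 = mem t12"
    by (simp_all add: t13_def r12 r11 r10 r9 r8 r7 r6 r5 r4 r3 r2 r1 r0 ev del: One_nat_def)
  define t14 where "t14 = exec_instr w (Op Add (F + 8) (F + 4) (F + 7)) t13"
  have r14: "regs t14 = (regs t13)(F + 8 := R + l)" and m14: "mem t14 = mem t13"
    by (simp_all add: t14_def r13 r12 r11 r10 r9 r8 r7 r6 r5 r4 r3 r2 r1 r0 ev del: One_nat_def)
  have s1: "s1 = t14"
    unfolding s1_def prologue_def t0_def[symmetric] fold_simps t1_def[symmetric] t2_def[symmetric]
      t3_def[symmetric] t4_def[symmetric] t5_def[symmetric] t6_def[symmetric] t7_def[symmetric]
      t8_def[symmetric] t9_def[symmetric] t10_def[symmetric] t11_def[symmetric] t12_def[symmetric]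
      t13_def[symmetric] t14_def[symmetric] ..
  have regs: "regs s1 = (regs s0)(F := 1, F + 10 := n, F + 9 := of_bool (b < e), F + 2 := b',
      F + 11 := of_bool (\<not> b < e), F + 3 := e * of_bool (b < e) mod M, F + 3 := e', F + 4 := c1,
      F + 4 := R, F + 5 := R + 1, F + 6 := b' + 1, F + 7 := l, F + 8 := R + l)"
    unfolding s1 r14 r13 r12 r11 r10 r9 r8 r7 r6 r5 r4 r3 r2 r1 r0 ..
  have "regs s1 (F + i) = call_values n b' e' c ! i" if "i < 9"
  proof -
    consider "i = 0" | "i = 1" | "i = 2" | "i = 3" | "i = 4" | "i = 5" | "i = 6" | "i = 7" | "i = 8"
      using \<open>i < 9\<close> by linarith
    then show ?thesis
      by cases (simp_all add: regs init F call_values_def R_def c1_def l_def del: One_nat_def)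
  qed
  then show "regs s1 (F + i) = (if b < e then call_values n b e c else call_values n 0 1 c) ! i" if "i < 9"
    using that by (simp add: b'_def e'_def)
  show "regs s1 (F + 9) = of_bool (b < e)"
    by (simp add: regs)
  show "regs s1 r = 0" if "3 \<le> r" "r < F"
    using that by (simp add: regs init)
  show "mem s1 = (mem s0)(0 := 0)"
    unfolding s1 m14 m13 m12 m11 m10 m9 m8 m7 m6 m5 m4 m3 m2 m1 m0 ..
qed

section \<open>Argument passing and the complete program\<close>

definition moves :: "nat \<Rightarrow> nat list \<Rightarrow> instr list" where
  "moves F srcs = map (\<lambda>i. Op Add i (F + srcs ! i) (F + 1)) [0..<length srcs]"

text \<open>Register \<open>F + 1\<close> holds 0, so each addition is a copy. Targets lie below
  \<open>F\<close> and sources at or above \<open>F\<close>, hence no copy destroys a source that is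
  still to be read.\<close>

lemma moves_state:
  assumes "length srcs \<le> F" "\<forall>i\<in>set srcs. regs s (F + i) < 2 ^ w" "regs s (F + 1) = 0"
  defines "s' \<equiv> fold (exec_instr w) (moves F srcs) s"
  shows "regs s' r = (if r < length srcs then regs s (F + srcs ! r) else regs s r)"
    and "mem s' = mem s"
proof -
  have "regs (fold (exec_instr w) (map (\<lambda>i. Op Add i (F + srcs ! i) (F + 1)) [0..<k]) s) r =
          (if r < k then regs s (F + srcs ! r) else regs s r) \<and>
        mem (fold (exec_instr w) (map (\<lambda>i. Op Add i (F + srcs ! i) (F + 1)) [0..<k]) s) = mem s"
    if "k \<le> length srcs" for k r
    using that
  proof (induction k arbitrary: r)
    case (Suc k)
    let ?t = "fold (exec_instr w) (map (\<lambda>i. Op Add i (F + srcs ! i) (F + 1)) [0..<k]) s"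
    have *: "\<not> F + j < k" for j
      using Suc.prems assms(1) by linarith
    have "srcs ! k \<in> set srcs"
      using Suc.prems by simp
    then have src: "regs s (F + srcs ! k) < 2 ^ w"
      using assms(2) by blast
    have IH: "regs ?t r = (if r < k then regs s (F + srcs ! r) else regs s r)" "mem ?t = mem s" for r
      using Suc.IH Suc.prems by simp_all
    have t: "fold (exec_instr w) (map (\<lambda>i. Op Add i (F + srcs ! i) (F + 1)) [0..<Suc k]) s =
        exec_instr w (Op Add k (F + srcs ! k) (F + 1)) ?t"
      by simp
    have "(regs s (F + srcs ! k) + regs s (F + 1)) mod 2 ^ w = regs s (F + srcs ! k)"
      using src assms(3) by simp
    then show ?case
      unfolding t using IH *[of 1] *[of "srcs ! k"] by auto
  qed simp
  then show "regs s' r = (if r < length srcs then regs s (F + srcs ! r) else regs s r)"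
    and "mem s' = mem s"
    by (simp_all add: s'_def moves_def)
qed

text \<open>The comparison yields 0 or 1, so multiplying by the flag in \<open>F + 9\<close> acts as
  conjunction with \<open>b < e\<close>.\<close>

definition epilogue :: "nat \<Rightarrow> bool \<Rightarrow> nat \<Rightarrow> instr list" where
  "epilogue F up k =
     [if up then Op Less 0 (F + k) 0 else Op Less 0 0 (F + k), Op Mul 0 0 (F + 9)]"

text \<open>The offset is the number of instructions in front of the shifted code: 14 for the
  prologue and one for each argument.\<close>

definition reduction_program :: "nat \<Rightarrow> nat list \<Rightarrow> bool \<Rightarrow> nat \<Rightarrow> instr list \<Rightarrow> instr list" where
  "reduction_program F srcs up k P =
     (prologue F @ moves F srcs) @ shift_program F (14 + length srcs) P @ epilogue F up k"

text \<open>The additive 22 consists of 14 instructions of the prologue, at most 6 copies and 2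
  instructions of the epilogue. The strict bound on \<open>length D\<close> leaves the last memory
  cell outside \<open>D\<close>, as the cyclic shift requires.\<close>

lemma reduction_program_run:
  fixes n b e c :: nat and srcs :: "nat list"
  defines "v \<equiv> (if b < e then call_values n b e c else call_values n 0 1 c)"
  defines "args \<equiv> map (\<lambda>i. v ! i) srcs"
  assumes regs: "\<forall>i\<in>set P. \<forall>r\<in>instr_regs i. r < F" and F: "6 \<le> F"
    and srcs: "3 \<le> length srcs" "length srcs \<le> 6" "\<forall>i\<in>set srcs. i < 9" and k: "k < 9"
    and n: "1 \<le> n" "b \<le> n" "e \<le> n" and bound: "(c + 2) * n + 1 < 2 ^ w"
    and D: "\<forall>x\<in>set D. x < 2 ^ w" "length D < 2 ^ w"
    and run: "halted P ((step w P ^^ t) (initial_config D args))"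
      "regs ((step w P ^^ t) (initial_config D args)) 0 = ans"
  shows "\<exists>t'\<le>2 * t + 22.
     let s = (step w (reduction_program F srcs up k P) ^^ t') (initial_config (n # D) [b, e, c])
     in halted (reduction_program F srcs up k P) s \<and>
        regs s 0 = of_bool (b < e \<and> (if up then v ! k < ans else ans < v ! k))"
proof -
  let ?pre = "prologue F @ moves F srcs"
  let ?B = "14 + length srcs"
  let ?Q = "reduction_program F srcs up k P"
  define s0 where "s0 = initial_config (n # D) [b, e, c]"
  define s1 where "s1 = fold (exec_instr w) (prologue F) s0"
  define s2 where "s2 = fold (exec_instr w) (moves F srcs) s1"
  have F3: "3 \<le> F"
    using F by simp
  note pro = prologue_state[OF F3 n bound, where D = D, folded s0_def, folded s1_def, folded v_def]
  have reg_v: "regs s1 (F + i) = v ! i" if "i < 9" for i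
    using pro(1) that .
  have "\<forall>x\<in>set v. x < 2 ^ w"
  proof -
    have *: "(c + 1) * n + n + 1 < 2 ^ w"
      using bound by (simp add: algebra_simps)
    show ?thesis
      using n * by (auto simp: v_def call_values_def)
  qed
  then have v_less: "v ! i < 2 ^ w" if "i < 9" for i
    using that by (auto simp: v_def call_values_def)
  have v01: "v ! 0 = 1" "v ! 1 = 0"
    by (auto simp: v_def call_values_def)
  have reg0: "regs s1 (F + 1) = 0" "regs s1 F = 1"
    using reg_v[of 1] reg_v[of 0] v01 by auto
  have src_v: "regs s1 (F + i) = v ! i" "v ! i < 2 ^ w" if "i \<in> set srcs" for i
    using srcs(3) that reg_v v_less by auto
  have lsF: "length srcs \<le> F"
    using F srcs by simp
  have mv: "regs s2 r = (if r < length srcs then regs s1 (F + srcs ! r) else regs s1 r)"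
    "mem s2 = mem s1" for r
    unfolding s2_def by (rule moves_state; use lsF src_v reg0 in auto)+
  have len: "length ?pre = ?B"
    by (simp add: prologue_def moves_def)
  have st: "\<forall>i\<in>set ?pre. straight i"
    by (auto simp: prologue_def moves_def)
  have Q: "?Q = [] @ ?pre @ (shift_program F ?B P @ epilogue F up k)"
    by (simp add: reduction_program_def)
  have pc0: "pc s0 = length ([] :: instr list)"
    by (simp add: s0_def initial_config_def)
  have s2: "(step w ?Q ^^ ?B) s0 = s2" "pc s2 = ?B"
    using run_straight_line[OF st pc0, of w] unfolding Q len by (auto simp: s1_def s2_def len)
  have one: "(1::nat) < 2 ^ w"
    using bound n by (intro le_less_trans[OF _ bound]) simp
  have sim: "simulates w F ?B P (regs s2) (initial_config D args) s2"
    unfolding simulates_def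
  proof (intro conjI)
    show "word_config w (initial_config D args)"
      using D src_v by (auto simp: word_config_def initial_config_def args_def)
    show "pc s2 = ?B + 2 * min (pc (initial_config D args)) (length P)"
      using s2 by (simp add: initial_config_def)
    \<comment> \<open>With at least three arguments, the copies overwrite the query in registers 0
      to 2; the remaining registers below \<open>F\<close> are still 0.\<close>
    show "\<forall>r<F. regs s2 r = regs (initial_config D args) r"
      using src_v srcs(1) pro(3) by (auto simp: mv initial_config_def args_def)
    show "\<forall>r\<ge>F. r \<noteq> F + 11 \<longrightarrow> regs s2 r = regs s2 r"
      by simp
    show "\<forall>a<2 ^ w. mem s2 ((a + 1) mod 2 ^ w) = mem (initial_config D args) a"
    proof (intro allI impI)
      fix a :: nat assume a: "a < 2 ^ w"
      show "mem s2 ((a + 1) mod 2 ^ w) = mem (initial_config D args) a"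
      \<comment> \<open>The last address wraps around to cell 0. It lies beyond \<open>D\<close> in
        the simulated memory, and cell 0 was cleared, so both contents are 0.\<close>
      proof (cases "a + 1 = 2 ^ w")
        case True
        then have "\<not> a < length D"
          using D(2) by simp
        moreover have "mem s2 ((a + 1) mod 2 ^ w) = 0"
          using True mv pro(4) by simp
        ultimately show ?thesis
          by (simp add: initial_config_def)
      next
        case False
        then have "(a + 1) mod 2 ^ w = a + 1"
          using a by simp
        then show ?thesis
          using mv pro(4) by (simp add: s0_def initial_config_def)
      qed
    qed
  qed
  have "regs s2 F = 1"
    using mv lsF reg0 by simp
  from simulates_run[OF sim this regs len, of t "epilogue F up k", folded reduction_program_def]
  obtain t' where t': "t' \<le> 2 * t"
    "simulates w F ?B P (regs s2) ((step w P ^^ t) (initial_config D args)) ((step w ?Q ^^ t') s2)"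
    by blast
  define s3 where "s3 = (step w ?Q ^^ t') s2"
  have s3: "pc s3 = length (?pre @ shift_program F ?B P)" "regs s3 0 = ans" "ans < 2 ^ w"
    using t'(2) run F len unfolding simulates_def s3_def word_config_def halted_def
    by (auto simp: length_shift_program)
  have "regs s3 (F + j) = regs s2 (F + j)" if "j < 11" for j
    using t'(2) that unfolding simulates_def s3_def by auto
  then have s3F: "regs s3 (F + j) = regs s1 (F + j)" if "j < 11" for j
    using that mv lsF by simp
  have ste: "\<forall>i\<in>set (epilogue F up k). straight i"
    by (auto simp: epilogue_def)
  define s4 where "s4 = fold (exec_instr w) (epilogue F up k) s3"
  have Q': "?Q = (?pre @ shift_program F ?B P) @ epilogue F up k @ []"
    by (simp add: reduction_program_def)
  have le: "length (epilogue F up k) = 2"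
    by (simp add: epilogue_def)
  have s4: "(step w ?Q ^^ 2) s3 = s4" "pc s4 = length ?Q"
    using run_straight_line(1)[OF ste s3(1), of w "[]"] run_straight_line(2)[OF ste s3(1), of w]
    unfolding Q' s4_def le by (simp_all add: le)
  have "regs s4 0 = of_bool (b < e \<and> (if up then v ! k < ans else ans < v ! k))"
    using s3F[of k] s3F[of 9] reg_v[of k] k pro(2) s3 F one
    by (auto simp: s4_def epilogue_def)
  moreover have "(step w ?Q ^^ (2 + (t' + ?B))) s0 = s4"
    unfolding funpow_add[of 2] funpow_add[of t' ?B] o_apply s2(1) s3_def[symmetric] by (rule s4(1))
  moreover have "2 + (t' + ?B) \<le> 2 * t + 22"
    using t' srcs by simp
  ultimately show ?thesis
    using s4(2) unfolding s0_def by (intro exI[of _ "2 + (t' + ?B)"])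
      (simp only: halted_def Let_def simp_thms order_refl)
qed

section \<open>The marker matrix and its grammar\<close>

lemma expands1_nonempty: "expands1 G N X \<Longrightarrow> X \<noteq> []"
  by (induction rule: expands1.induct) auto

lemma expands1_unique: "expands1 G N X \<Longrightarrow> expands1 G N Y \<Longrightarrow> X = Y"
proof (induction arbitrary: Y rule: expands1.induct)
  case (1 N a)
  from 1(3) show ?case
    using 1(1,2) by cases auto
next
  case (2 N A B X Z)
  from 2(7) obtain X' Z' where "expands1 G A X'" "expands1 G B Z'" "Y = X' @ Z'"
    by cases (use 2(2) in auto)
  then show ?case
    using 2(5,6) by simp
qed

text \<open>\<open>V\<close> collects the nonterminals of the derivation tree of \<open>X\<close>.
  The tree has \<open>length X\<close> leaves and therefore \<open>2 * length X - 1\<close> nodes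
  when every terminal is merged with its parent.\<close>

lemma expands1_trim:
  assumes "expands1 G N X"
  obtains V where "finite V" "N \<in> V" "V \<subseteq> nonterms1 G" "card V < 2 * length X"
    "\<And>M. M \<in> V \<Longrightarrow> rhs_nonterms (rule1 G M) \<subseteq> V"
    "\<And>M. M \<in> V \<Longrightarrow> \<exists>Y. expands1 G M Y"
proof -
  have "\<exists>V. finite V \<and> N \<in> V \<and> V \<subseteq> nonterms1 G \<and> card V < 2 * length X \<and>
      (\<forall>M\<in>V. rhs_nonterms (rule1 G M) \<subseteq> V) \<and> (\<forall>M\<in>V. \<exists>Y. expands1 G M Y)"
    using assms
  proof (induction rule: expands1.induct)
    case (1 N a)
    then show ?case
      by (intro exI[of _ "{N}"]) (auto intro: expands1.intros)
  next
    case (2 N A B X Y)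
    then obtain V W where V: "finite V" "A \<in> V" "V \<subseteq> nonterms1 G" "card V < 2 * length X"
        "\<forall>M\<in>V. rhs_nonterms (rule1 G M) \<subseteq> V" "\<forall>M\<in>V. \<exists>Y. expands1 G M Y"
      and W: "finite W" "B \<in> W" "W \<subseteq> nonterms1 G" "card W < 2 * length Y"
        "\<forall>M\<in>W. rhs_nonterms (rule1 G M) \<subseteq> W" "\<forall>M\<in>W. \<exists>Y. expands1 G M Y"
      by auto
    have "card (insert N (V \<union> W)) \<le> Suc (card V + card W)"
      using V(1) W(1) card_Un_le[of V W] by (simp add: card_insert_if)
    then have "card (insert N (V \<union> W)) < 2 * length (X @ Y)"
      using V(4) W(4) by simp
    moreover have "\<exists>Z. expands1 G N Z"
      using 2 by (blast intro: expands1.intros)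
    ultimately show ?case
      using V W 2(1,2) by (intro exI[of _ "insert N (V \<union> W)"]) auto
  qed
  then show thesis
    using that by blast
qed

text \<open>The heights met when a column of \<open>h\<close> zeros is built from single cells by
  doubling an even height and by adding one cell to an odd one. The value at 0 is a default.\<close>

function halving_heights :: "nat \<Rightarrow> nat set" where
  "halving_heights h = (if h \<le> 1 then {1} else if even h then insert h (halving_heights (h div 2))
     else insert h (halving_heights (h - 1)))"
  by auto
termination by (relation "measure id") auto

declare halving_heights.simps [simp del]

lemma halving_heights_induct:
  assumes "\<And>h. h \<le> 1 \<Longrightarrow> P h {1}"
    and "\<And>h. 1 < h \<Longrightarrow> even h \<Longrightarrow> P (h div 2) (halving_heights (h div 2)) \<Longrightarrow>
      P h (insert h (halving_heights (h div 2)))"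
    and "\<And>h. 1 < h \<Longrightarrow> odd h \<Longrightarrow> P (h - 1) (halving_heights (h - 1)) \<Longrightarrow>
      P h (insert h (halving_heights (h - 1)))"
  shows "P h (halving_heights h)"
proof (induction h rule: less_induct)
  case (less h)
  consider "h \<le> 1" | "1 < h" "even h" | "1 < h" "odd h"
    by linarith
  then show ?case
    by cases (use less assms in \<open>simp_all add: halving_heights.simps[of h]\<close>)
qed

lemma finite_halving_heights: "finite (halving_heights h)"
  by (rule halving_heights_induct) auto

lemma self_in_halving_heights: "0 < h \<Longrightarrow> h \<in> halving_heights h"
  by (auto simp: halving_heights.simps[of h])

lemma halving_heights_pos: "x \<in> halving_heights h \<Longrightarrow> 0 < x"
  by (rule halving_heights_induct[of "\<lambda>_ H. x \<in> H \<longrightarrow> 0 < x", THEN mp]) auto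

text \<open>This guarantees that the rule for a zero column refers only to zero columns that also
  have a rule.\<close>

lemma halving_heights_closed:
  assumes "x \<in> halving_heights h" "1 < x"
  shows "(if even x then x div 2 else x - 1) \<in> halving_heights h"
proof (rule halving_heights_induct[of "\<lambda>_ H. x \<in> H \<longrightarrow> (if even x then x div 2 else x - 1) \<in> H", THEN mp])
  show "x \<in> halving_heights h"
    by fact
next
  fix h :: nat assume "1 < h" "even h"
  then have "h div 2 \<in> halving_heights (h div 2)"
    by (intro self_in_halving_heights) auto
  then show "x \<in> insert h (halving_heights (h div 2)) \<longrightarrow>
      (if even x then x div 2 else x - 1) \<in> insert h (halving_heights (h div 2))"
    if "x \<in> halving_heights (h div 2) \<longrightarrow>
      (if even x then x div 2 else x - 1) \<in> halving_heights (h div 2)"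
    using that \<open>even h\<close> by auto
next
  fix h :: nat assume "1 < h" "odd h"
  then have "h - 1 \<in> halving_heights (h - 1)"
    by (intro self_in_halving_heights) auto
  then show "x \<in> insert h (halving_heights (h - 1)) \<longrightarrow>
      (if even x then x div 2 else x - 1) \<in> insert h (halving_heights (h - 1))"
    if "x \<in> halving_heights (h - 1) \<longrightarrow>
      (if even x then x div 2 else x - 1) \<in> halving_heights (h - 1)"
    using that \<open>odd h\<close> by auto
qed (use assms(2) in auto)

text \<open>Passing from \<open>h\<close> to \<open>h div 2\<close> adds at most two heights,
  \<open>h\<close> and, for odd \<open>h\<close>, also \<open>h - 1\<close>; each such passage
  lowers the binary length by one.\<close>

lemma card_halving_heights: "h < 2 ^ Suc k \<Longrightarrow> card (halving_heights h) \<le> 2 * k + 1"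
proof (induction k arbitrary: h)
  case 0
  then show ?case
    by (simp add: halving_heights.simps)
next
  case (Suc k)
  have half: "card (halving_heights (h div 2)) \<le> 2 * k + 1"
    using Suc by simp
  have ins: "card (insert x H) \<le> Suc (card H)" if "finite H" for x :: nat and H
    using that by (simp add: card_insert_if)
  consider "h \<le> 1" | "1 < h" "even h" | "1 < h" "odd h"
    by linarith
  then show ?case
  proof cases
    case 1
    then show ?thesis
      by (simp add: halving_heights.simps)
  next
    case 2
    then have "halving_heights h = insert h (halving_heights (h div 2))"
      by (simp add: halving_heights.simps[of h])
    then show ?thesis
      using half ins[OF finite_halving_heights, of h "h div 2"] by simp
  next
    case 3
    \<comment> \<open>The odd case unfolds the recursion twice, once for the decrement and once for
      the halving that must follow it.\<close>
    then obtain m where m: "h = 2 * m + 1" "0 < m"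
      by (auto elim!: oddE)
    then have "halving_heights h = insert h (insert (h - 1) (halving_heights (h div 2)))"
      by (simp add: halving_heights.simps[of "Suc (2 * m)"] halving_heights.simps[of "2 * m"])
    moreover have "card (insert h (insert (h - 1) (halving_heights (h div 2))))
        \<le> Suc (Suc (card (halving_heights (h div 2))))"
      by (meson ins finite_halving_heights finite_insert order_trans Suc_le_mono)
    ultimately show ?thesis
      using half by simp
  qed
qed

text \<open>The summand in \<open>X ! j + 1\<close> leaves \<open>n\<close> zero rows on top, and
  the row count leaves \<open>n\<close> rows below the marker row of the largest letter
  \<open>\<sigma> - 1\<close>.\<close>

definition marker_matrix :: "nat \<Rightarrow> nat \<Rightarrow> nat list \<Rightarrow> nat mat" where
  "marker_matrix \<sigma> n X =
     mat ((\<sigma> + 1) * n + 1) (length X) (\<lambda>(i, j). of_bool (i = (X ! j + 1) * n))"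

section \<open>The 2D grammar of the marker matrix\<close>

locale marker_grammar =
  fixes G :: "(nat, nat) slp1" and V :: "nat set" and \<sigma> n :: nat
  assumes V: "finite V" "V \<subseteq> nonterms1 G" "start1 G \<in> V"
    and closed: "M \<in> V \<Longrightarrow> rhs_nonterms (rule1 G M) \<subseteq> V"
    and expandable: "M \<in> V \<Longrightarrow> \<exists>Y. expands1 G M Y"
    and letter_less: "M \<in> V \<Longrightarrow> rule1 G M = Lit a \<Longrightarrow> a < \<sigma>"
    and n_pos: "0 < n"
begin

text \<open>Nonterminals of the 2D grammar are coded by residues modulo 4: \<open>4 * h\<close> is a column of \<open>h\<close>
  zeros, \<open>1\<close> is the symbol 1, \<open>4 * a + 2\<close> is the part of the column of letter \<open>a\<close> from its 1
  downwards, and \<open>4 * N + 3\<close> is the matrix of the string derived from \<open>N\<close>.\<close>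

definition marker_rule :: "nat \<Rightarrow> (nat, nat) rhs" where
  "marker_rule x =
     (let y = x div 4 in
      if x mod 4 = 0 then
        (if y = 1 then Lit 0 else if even y then Bin (4 * (y div 2)) (4 * (y div 2))
         else Bin 4 (4 * (y - 1)))
      else if x mod 4 = 1 then Lit 1
      else if x mod 4 = 2 then Bin 1 (4 * ((\<sigma> - y) * n))
      else (case rule1 G y of
          Lit a \<Rightarrow> Bin (4 * ((a + 1) * n)) (4 * a + 2)
        | Bin A B \<Rightarrow> Bin (4 * A + 3) (4 * B + 3)))"

lemma codes [simp]:
  "(4 * h) div 4 = (h::nat)" "(4 * h) mod 4 = (0::nat)"
  "(4 * a + 2) div 4 = (a::nat)" "(4 * a + 2) mod 4 = (2::nat)"
  "(4 * N + 3) div 4 = (N::nat)" "(4 * N + 3) mod 4 = (3::nat)"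
  by presburger+

lemma marker_rule_simps:
  "marker_rule 4 = Lit 0"
  "marker_rule 1 = Lit 1"
  "h \<noteq> 1 \<Longrightarrow> even h \<Longrightarrow> marker_rule (4 * h) = Bin (4 * (h div 2)) (4 * (h div 2))"
  "h \<noteq> 1 \<Longrightarrow> odd h \<Longrightarrow> marker_rule (4 * h) = Bin 4 (4 * (h - 1))"
  "marker_rule (4 * a + 2) = Bin 1 (4 * ((\<sigma> - a) * n))"
  "rule1 G N = Lit a \<Longrightarrow> marker_rule (4 * N + 3) = Bin (4 * ((a + 1) * n)) (4 * a + 2)"
  "rule1 G N = Bin A B \<Longrightarrow> marker_rule (4 * N + 3) = Bin (4 * A + 3) (4 * B + 3)"
  unfolding marker_rule_def Let_def codes by simp_all

text \<open>Only letters produced by a rule in \<open>V\<close> receive columns, so their number is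
  bounded by \<open>card V\<close> and not merely by \<open>\<sigma>\<close>.\<close>

definition letters :: "nat set" where
  "letters = {a. \<exists>N\<in>V. rule1 G N = Lit a}"

text \<open>The column of \<open>a\<close> has \<open>(a + 1) * n\<close> zeros above its 1 and
  \<open>(\<sigma> - a) * n\<close> below. Height 1 is always included because it is the base of
  every zero column.\<close>

definition heights :: "nat set" where
  "heights = insert 1 (\<Union>a\<in>letters. halving_heights ((a + 1) * n) \<union> halving_heights ((\<sigma> - a) * n))"

definition marker_slp2 :: "(nat, nat) slp2" where
  "marker_slp2 =
     \<lparr>lit_nonterms = {1, 4},
      hor_nonterms = (\<lambda>h. 4 * h) ` (heights - {1}) \<union> (\<lambda>a. 4 * a + 2) ` letters \<union>
        (\<lambda>N. 4 * N + 3) ` {N \<in> V. \<exists>a. rule1 G N = Lit a},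
      ver_nonterms = (\<lambda>N. 4 * N + 3) ` {N \<in> V. \<exists>A B. rule1 G N = Bin A B},
      alphabet2 = {0, 1},
      rule2 = marker_rule,
      start2 = 4 * start1 G + 3\<rparr>"

lemma letters_card: "finite letters" "card letters \<le> card V"
proof -
  have "letters \<subseteq> (\<lambda>N. case rule1 G N of Lit a \<Rightarrow> a | _ \<Rightarrow> 0) ` V"
    by (force simp: letters_def)
  then show "finite letters" "card letters \<le> card V"
    using V(1) by (auto intro: finite_surj surj_card_le)
qed

lemma letters_less: "a \<in> letters \<Longrightarrow> a < \<sigma>"
  using letter_less by (auto simp: letters_def)

lemma height_closed:
  assumes "h \<in> heights" "1 < h"
  shows "even h \<Longrightarrow> h div 2 \<in> heights" "odd h \<Longrightarrow> h - 1 \<in> heights"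
proof -
  obtain a where a: "a \<in> letters" "h \<in> halving_heights ((a + 1) * n) \<union> halving_heights ((\<sigma> - a) * n)"
    using assms by (auto simp: heights_def)
  then have "(if even h then h div 2 else h - 1) \<in> halving_heights ((a + 1) * n) \<union> halving_heights ((\<sigma> - a) * n)"
    using halving_heights_closed assms(2) by blast
  then have "(if even h then h div 2 else h - 1) \<in> heights"
    using a(1) unfolding heights_def by blast
  then show "even h \<Longrightarrow> h div 2 \<in> heights" "odd h \<Longrightarrow> h - 1 \<in> heights"
    by auto
qed

lemma height_pos: "h \<in> heights \<Longrightarrow> 0 < h"
  using halving_heights_pos by (auto simp: heights_def)

lemma letter_heights:
  assumes "a \<in> letters"
  shows "(a + 1) * n \<in> heights" "(\<sigma> - a) * n \<in> heights"
proof -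
  have "(a + 1) * n \<in> halving_heights ((a + 1) * n)" "(\<sigma> - a) * n \<in> halving_heights ((\<sigma> - a) * n)"
    using n_pos letters_less[OF assms] by (auto intro!: self_in_halving_heights)
  then show "(a + 1) * n \<in> heights" "(\<sigma> - a) * n \<in> heights"
    using assms unfolding heights_def by blast+
qed

lemma zero_code_nonterm: "h \<in> heights \<Longrightarrow> 4 * h \<in> nonterms2 marker_slp2"
  by (auto simp: nonterms2_def marker_slp2_def)

lemma nt_code_nonterm: "N \<in> V \<Longrightarrow> 4 * N + 3 \<in> nonterms2 marker_slp2"
  by (cases "rule1 G N") (auto simp: nonterms2_def marker_slp2_def)

text \<open>Case rule behind the structural checks: it combines the shape of a code with its kind,
  its rule and the membership of the needed children.\<close>

lemma marker_nonterm_cases: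
  assumes "x \<in> nonterms2 marker_slp2"
  obtains (one) "x = 1" "x \<in> lit_nonterms marker_slp2" "marker_rule x = Lit 1"
  | (zero) "x = 4" "x \<in> lit_nonterms marker_slp2" "marker_rule x = Lit 0"
  | (even) h where "x = 4 * h" "h \<in> heights" "1 < h" "even h" "x \<in> hor_nonterms marker_slp2"
      "marker_rule x = Bin (4 * (h div 2)) (4 * (h div 2))" "h div 2 \<in> heights"
  | (odd) h where "x = 4 * h" "h \<in> heights" "1 < h" "odd h" "x \<in> hor_nonterms marker_slp2"
      "marker_rule x = Bin 4 (4 * (h - 1))" "h - 1 \<in> heights"
  | (tail) a where "x = 4 * a + 2" "a \<in> letters" "x \<in> hor_nonterms marker_slp2"
      "marker_rule x = Bin 1 (4 * ((\<sigma> - a) * n))"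
  | (leaf) N a where "x = 4 * N + 3" "N \<in> V" "rule1 G N = Lit a" "a \<in> letters"
      "x \<in> hor_nonterms marker_slp2" "marker_rule x = Bin (4 * ((a + 1) * n)) (4 * a + 2)"
  | (inner) N A B where "x = 4 * N + 3" "N \<in> V" "rule1 G N = Bin A B" "A \<in> V" "B \<in> V"
      "x \<in> ver_nonterms marker_slp2" "marker_rule x = Bin (4 * A + 3) (4 * B + 3)"
proof -
  consider "x = 1" | "x = 4" | h where "x = 4 * h" "h \<in> heights" "h \<noteq> 1"
    | a where "x = 4 * a + 2" "a \<in> letters"
    | N a where "x = 4 * N + 3" "N \<in> V" "rule1 G N = Lit a"
    | N A B where "x = 4 * N + 3" "N \<in> V" "rule1 G N = Bin A B"
    using assms by (auto simp: nonterms2_def marker_slp2_def)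
  then show thesis
  proof cases
    case 1
    then show ?thesis using one by (simp add: marker_slp2_def marker_rule_simps del: One_nat_def)
  next
    case 2
    then show ?thesis using zero by (simp add: marker_slp2_def marker_rule_simps)
  next
    case (3 h)
    then have h: "1 < h" "x \<in> hor_nonterms marker_slp2"
      using height_pos[of h] by (auto simp: marker_slp2_def)
    show ?thesis
    proof (cases "even h")
      case True
      then show ?thesis
        using even[OF 3(1,2) h(1)] 3 h height_closed marker_rule_simps(3) by simp
    next
      case False
      then show ?thesis
        using odd[OF 3(1,2) h(1)] 3 h height_closed marker_rule_simps(4) by simp
    qed
  next
    case (4 a)
    then have "x \<in> hor_nonterms marker_slp2"
      by (auto simp: marker_slp2_def)
    then show ?thesis
      using tail[OF 4] marker_rule_simps(5)[of a] unfolding 4(1) by blast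
  next
    case (5 N a)
    then show ?thesis
      using leaf[OF 5] marker_rule_simps(6)[OF 5(3)] by (auto simp: marker_slp2_def letters_def)
  next
    case (6 N A B)
    then show ?thesis
      using inner[OF 6] marker_rule_simps(7)[OF 6(3)] closed[OF 6(2)] by (auto simp: marker_slp2_def)
  qed
qed

section \<open>Dimensions of the expansions\<close>

lemma marker_slp2_disjoint:
  "lit_nonterms marker_slp2 \<inter> hor_nonterms marker_slp2 = {}"
  "lit_nonterms marker_slp2 \<inter> ver_nonterms marker_slp2 = {}"
  "hor_nonterms marker_slp2 \<inter> ver_nonterms marker_slp2 = {}"
  unfolding marker_slp2_def by (auto; presburger)+

text \<open>The row count of the expansion, read off the code alone, so that dimensions can be
  compared by arithmetic without knowing the matrices.\<close>

definition rows :: "nat \<Rightarrow> nat" where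
  "rows x =
     (if x mod 4 = 0 then x div 4 else if x mod 4 = 1 then 1
      else if x mod 4 = 2 then 1 + (\<sigma> - x div 4) * n else (\<sigma> + 1) * n + 1)"

lemma rows_simps:
  "rows 1 = 1" "rows 4 = 1" "rows (4 * h) = h" "rows (4 * a + 2) = 1 + (\<sigma> - a) * n"
  "rows (4 * N + 3) = (\<sigma> + 1) * n + 1"
  unfolding rows_def codes by simp_all

lemma letter_rows: "a < \<sigma> \<Longrightarrow> (a + 1) * n + (1 + (\<sigma> - a) * n) = (\<sigma> + 1) * n + 1"
proof -
  assume "a < \<sigma>"
  then have "(a + 1) + (\<sigma> - a) = \<sigma> + 1"
    by simp
  then show ?thesis
    by (metis add.assoc add.commute distrib_right)
qed

text \<open>No child of a horizontal rule has residue 3, whereas all vertical nonterminals do. Hence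
  horizontal rules stack single columns only, which gives equal column counts.\<close>

lemma marker_hor_children:
  assumes x: "x \<in> hor_nonterms marker_slp2" and r: "marker_rule x = Bin A B"
  shows "rows A + rows B = rows x" "A \<notin> ver_nonterms marker_slp2" "B \<notin> ver_nonterms marker_slp2"
proof -
  have "x \<in> nonterms2 marker_slp2"
    using x by (simp add: nonterms2_def)
  then have "rows A + rows B = rows x \<and> A mod 4 \<noteq> 3 \<and> B mod 4 \<noteq> 3"
  proof (cases rule: marker_nonterm_cases)
    case (even h)
    then have AB: "A = 4 * (h div 2)" "B = 4 * (h div 2)"
      using r by auto
    show ?thesis
      unfolding AB even(1) rows_simps codes using even(4) by auto
  next
    case (odd h)
    then have AB: "A = 4" "B = 4 * (h - 1)"
      using r by auto
    show ?thesis
      unfolding AB odd(1) rows_simps codes using odd(3) by auto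
  next
    case (tail a)
    then have AB: "A = 1" "B = 4 * ((\<sigma> - a) * n)"
      using r by auto
    show ?thesis
      unfolding AB tail(1) rows_simps codes by simp
  next
    case (leaf N a)
    then have AB: "A = 4 * ((a + 1) * n)" "B = 4 * a + 2"
      using r by auto
    show ?thesis
      unfolding AB leaf(1) rows_simps codes using letter_rows[OF letters_less[OF leaf(4)]] by simp
  next
    case (inner N A' B')
    then show ?thesis
      using marker_slp2_disjoint x by auto
  qed (use r in simp_all)
  moreover have "y mod 4 = 3" if "y \<in> ver_nonterms marker_slp2" for y
    using that unfolding marker_slp2_def by auto
  ultimately show "rows A + rows B = rows x" "A \<notin> ver_nonterms marker_slp2" "B \<notin> ver_nonterms marker_slp2"
    by auto
qed

lemma marker_dims:
  "expands2 marker_slp2 x X \<Longrightarrow>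
     dim_row X = rows x \<and> (x \<notin> ver_nonterms marker_slp2 \<longrightarrow> dim_col X = 1)"
proof (induction rule: expands2.induct)
  case (1 x a)
  then show ?case
    by (auto simp: marker_slp2_def rows_simps simp del: One_nat_def)
next
  case (2 x A B X Y)
  have "marker_rule x = Bin A B"
    using 2(2) by (simp add: marker_slp2_def)
  then show ?case
    using marker_hor_children[OF 2(1)] 2(5,6) by (auto simp: on_top_of_def)
next
  case (3 x A B X Y)
  have r: "marker_rule x = Bin A B"
    using 3(2) by (simp add: marker_slp2_def)
  obtain N A' B' where N: "N \<in> V" "x = 4 * N + 3" "rule1 G N = Bin A' B'"
    using 3(1) by (auto simp: marker_slp2_def)
  then have "A = 4 * A' + 3"
    using r marker_rule_simps(7)[OF N(3)] by simp
  then have "rows A = rows x"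
    unfolding N(2) by (simp only: rows_simps)
  then show ?case
    using 3 by (simp add: left_of_def)
qed

section \<open>Acyclicity and well-formedness of the grammar\<close>

definition derived_length :: "nat \<Rightarrow> nat" where
  "derived_length N = length (THE X. expands1 G N X)"

lemma derived_length_eq: "expands1 G N X \<Longrightarrow> derived_length N = length X"
  unfolding derived_length_def using expands1_unique by (metis the_equality)

lemma derived_length_Bin:
  assumes "N \<in> V" "rule1 G N = Bin A B"
  shows "derived_length A < derived_length N" "derived_length B < derived_length N"
proof -
  have "A \<in> V" "B \<in> V"
    using closed[OF assms(1)] assms(2) by auto
  then obtain X Y where XY: "expands1 G A X" "expands1 G B Y"
    using expandable by blast
  then have "expands1 G N (X @ Y)"
    using assms V by (auto intro: expands1.intros)
  then show "derived_length A < derived_length N" "derived_length B < derived_length N"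
    using XY expands1_nonempty[OF XY(1)] expands1_nonempty[OF XY(2)] by (auto simp: derived_length_eq)
qed

lemma derived_length_pos: "N \<in> V \<Longrightarrow> 0 < derived_length N"
  using expandable expands1_nonempty derived_length_eq by fastforce

text \<open>A measure decreases from each nonterminal to its children. Children of horizontal rules
  have fewer rows; vertical rules keep the row count but pass to shorter strings, since the other
  factor is nonempty.\<close>

lemma marker_acyclic: "acyclic (occurs_in_rule (nonterms2 marker_slp2) marker_rule)"
proof -
  define f where "f x = (if x mod 4 = 3 then rows x + derived_length (x div 4) else rows x)" for x
  have f: "f 1 = 1" "f 4 = 1" "f (4 * h) = h" "f (4 * a + 2) = 1 + (\<sigma> - a) * n"
    "f (4 * N + 3) = (\<sigma> + 1) * n + 1 + derived_length N" for h a N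
    unfolding f_def codes rows_simps by simp_all
  have "f y < f x" if "x \<in> nonterms2 marker_slp2" "y \<in> rhs_nonterms (marker_rule x)" for x y
    using that(1)
  proof (cases rule: marker_nonterm_cases)
    case (even h)
    then have y: "y = 4 * (h div 2)"
      using that(2) by auto
    show ?thesis
      unfolding y even(1) f using even by simp
  next
    case (odd h)
    then have "y = 4 \<or> y = 4 * (h - 1)"
      using that(2) by auto
    then show ?thesis
      using odd(3) unfolding odd(1) by (auto simp only: f)
  next
    case (tail a)
    then have "y = 1 \<or> y = 4 * ((\<sigma> - a) * n)"
      using that(2) by auto
    then show ?thesis
    proof -
      have "0 < (\<sigma> - a) * n"
        using letters_less[OF tail(2)] n_pos by simp
      with \<open>y = 1 \<or> _\<close> show ?thesis
        unfolding tail(1) by (elim disjE; simp only: f; linarith)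
    qed
  next
    case (leaf N a)
    then have "y = 4 * ((a + 1) * n) \<or> y = 4 * a + 2"
      using that(2) by auto
    moreover have "(a + 1) * n < (\<sigma> + 1) * n + 1 + derived_length N"
      "1 + (\<sigma> - a) * n < (\<sigma> + 1) * n + 1 + derived_length N"
      using letter_rows[OF letters_less[OF leaf(4)]] derived_length_pos[OF leaf(2)] by linarith+
    ultimately show ?thesis
      unfolding leaf(1) by (auto simp only: f)
  next
    case (inner N A B)
    then have "y = 4 * A + 3 \<or> y = 4 * B + 3"
      using that(2) by auto
    then show ?thesis
      using derived_length_Bin[OF inner(2,3)] unfolding inner(1) by (auto simp only: f)
  qed (use that(2) in simp_all)
  then have "occurs_in_rule (nonterms2 marker_slp2) marker_rule \<subseteq> measure f"
    by (auto simp: occurs_in_rule_def)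
  then show ?thesis
    using acyclic_subset wf_acyclic[OF wf_measure] by blast
qed

lemma finite_heights: "finite heights"
  unfolding heights_def using letters_card finite_halving_heights by auto

lemma finite_marker_nonterms: "finite (nonterms2 marker_slp2)"
  unfolding nonterms2_def marker_slp2_def using finite_heights letters_card V(1) by auto

lemma is_slp2_marker: "is_slp2 marker_slp2"
  unfolding is_slp2_def
proof (intro conjI ballI allI impI)
  show "finite (alphabet2 marker_slp2)"
    by (simp add: marker_slp2_def)
  show "start2 marker_slp2 \<in> nonterms2 marker_slp2"
    using nt_code_nonterm[OF V(3)] by (simp add: marker_slp2_def)
  show "acyclic (occurs_in_rule (nonterms2 marker_slp2) (rule2 marker_slp2))"
    using marker_acyclic by (simp add: marker_slp2_def)
next
  fix N assume "N \<in> lit_nonterms marker_slp2"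
  then show "\<exists>a\<in>alphabet2 marker_slp2. rule2 marker_slp2 N = Lit a"
    by (auto simp: marker_slp2_def marker_rule_simps simp del: One_nat_def)
next
  fix x assume x: "x \<in> hor_nonterms marker_slp2 \<union> ver_nonterms marker_slp2"
  then have nt: "x \<in> nonterms2 marker_slp2"
    by (auto simp: nonterms2_def)
  have lit: "1 \<in> nonterms2 marker_slp2" "4 \<in> nonterms2 marker_slp2"
    by (auto simp: nonterms2_def marker_slp2_def)
  have tl: "4 * a + 2 \<in> nonterms2 marker_slp2" if "a \<in> letters" for a
    using that by (auto simp: nonterms2_def marker_slp2_def)
  have "\<exists>A\<in>nonterms2 marker_slp2. \<exists>B\<in>nonterms2 marker_slp2. marker_rule x = Bin A B"
    using nt
  proof (cases rule: marker_nonterm_cases)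
    case one
    then show ?thesis using x marker_slp2_disjoint by blast
  next
    case zero
    then show ?thesis using x marker_slp2_disjoint by blast
  next
    case (even h)
    then show ?thesis using zero_code_nonterm by blast
  next
    case (odd h)
    then show ?thesis using zero_code_nonterm lit by blast
  next
    case (tail a)
    then show ?thesis using zero_code_nonterm[OF letter_heights(2)] lit by blast
  next
    case (leaf N a)
    then show ?thesis using zero_code_nonterm[OF letter_heights(1)] tl by blast
  next
    case (inner N A B)
    then show ?thesis using nt_code_nonterm by blast
  qed
  then show "\<exists>A\<in>nonterms2 marker_slp2. \<exists>B\<in>nonterms2 marker_slp2. rule2 marker_slp2 x = Bin A B"
    by (simp add: marker_slp2_def)
next
  fix x A B X Y
  assume x: "x \<in> hor_nonterms marker_slp2" "rule2 marker_slp2 x = Bin A B"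
    and XY: "expands2 marker_slp2 A X" "expands2 marker_slp2 B Y"
  have "marker_rule x = Bin A B"
    using x by (simp add: marker_slp2_def)
  then have "A \<notin> ver_nonterms marker_slp2" "B \<notin> ver_nonterms marker_slp2"
    using marker_hor_children(2,3) x by blast+
  then show "dim_col X = dim_col Y"
    using marker_dims XY by metis
next
  fix x A B X Y
  assume x: "x \<in> ver_nonterms marker_slp2" "rule2 marker_slp2 x = Bin A B"
    and XY: "expands2 marker_slp2 A X" "expands2 marker_slp2 B Y"
  obtain N A' B' where N: "x = 4 * N + 3" "rule1 G N = Bin A' B'"
    using x(1) by (auto simp: marker_slp2_def)
  then have "A = 4 * A' + 3" "B = 4 * B' + 3"
    using x(2) marker_rule_simps(7)[OF N(2)] by (simp_all add: marker_slp2_def)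
  then show "dim_row X = dim_row Y"
    using marker_dims[OF XY(1)] marker_dims[OF XY(2)] rows_simps(5) by metis
qed (rule finite_marker_nonterms marker_slp2_disjoint)+

section \<open>Expansions of the grammar\<close>

lemma marker_zero_column: "h \<in> heights \<Longrightarrow> expands2 marker_slp2 (4 * h) (mat h 1 (\<lambda>_. 0))"
proof (induction h rule: less_induct)
  case (less h)
  have one: "expands2 marker_slp2 4 (mat 1 1 (\<lambda>_. 0))"
    by (rule expands2.intros) (simp_all add: marker_slp2_def marker_rule_simps)
  have stack: "on_top_of (mat h 1 (\<lambda>_. 0)) (mat h' 1 (\<lambda>_. 0)) = mat (h + h') 1 (\<lambda>_. 0)" for h h'
    by (rule eq_matI) (auto simp: on_top_of_def)
  show ?case
  proof (cases "h = 1")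
    case True
    then show ?thesis
      using one by simp
  next
    case False
    then have h: "1 < h"
      using height_pos[OF less(2)] by simp
    have hor: "4 * h \<in> hor_nonterms marker_slp2"
      using less(2) False by (auto simp: marker_slp2_def)
    show ?thesis
    proof (cases "even h")
      case True
      have "expands2 marker_slp2 (4 * (h div 2)) (mat (h div 2) 1 (\<lambda>_. 0))"
        using less h height_closed(1)[OF less(2) h True] by simp
      then have "expands2 marker_slp2 (4 * h) (on_top_of (mat (h div 2) 1 (\<lambda>_. 0)) (mat (h div 2) 1 (\<lambda>_. 0)))"
        using hor marker_rule_simps(3)[OF False True]
        by (intro expands2.intros(2)) (auto simp: marker_slp2_def)
      then show ?thesis
        using True unfolding stack by (auto elim!: evenE simp flip: mult_2)
    next
      case odd: False
      have "expands2 marker_slp2 (4 * (h - 1)) (mat (h - 1) 1 (\<lambda>_. 0))"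
        using less h height_closed(2)[OF less(2) h odd] by simp
      then have "expands2 marker_slp2 (4 * h) (on_top_of (mat 1 1 (\<lambda>_. 0)) (mat (h - 1) 1 (\<lambda>_. 0)))"
        using one hor marker_rule_simps(4)[OF False odd]
        by (intro expands2.intros(2)) (auto simp: marker_slp2_def)
      then show ?thesis
        using h unfolding stack by simp
    qed
  qed
qed

lemma marker_letter:
  assumes "N \<in> V" "rule1 G N = Lit a"
  shows "expands2 marker_slp2 (4 * N + 3) (marker_matrix \<sigma> n [a])"
proof -
  have a: "a \<in> letters"
    using assms by (auto simp: letters_def)
  let ?T = "on_top_of (mat 1 1 (\<lambda>_. 1)) (mat ((\<sigma> - a) * n) 1 (\<lambda>_. 0)) :: nat mat"
  have "expands2 marker_slp2 1 (mat 1 1 (\<lambda>_. 1))"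
    by (rule expands2.intros) (simp_all add: marker_slp2_def marker_rule_simps del: One_nat_def)
  moreover have "4 * a + 2 \<in> hor_nonterms marker_slp2" "4 * N + 3 \<in> hor_nonterms marker_slp2"
    using a assms by (auto simp: marker_slp2_def)
  moreover have r: "rule2 marker_slp2 = marker_rule"
    by (simp add: marker_slp2_def)
  ultimately have "expands2 marker_slp2 (4 * N + 3) (on_top_of (mat ((a + 1) * n) 1 (\<lambda>_. 0)) ?T)"
    using expands2.intros(2)[of "4 * a + 2" marker_slp2, unfolded r, OF _ marker_rule_simps(5) _
        marker_zero_column[OF letter_heights(2)[OF a]]]
      expands2.intros(2)[of "4 * N + 3" marker_slp2, unfolded r, OF _ marker_rule_simps(6)[OF assms(2)]
        marker_zero_column[OF letter_heights(1)[OF a]]]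
    by blast
  moreover have "on_top_of (mat ((a + 1) * n) 1 (\<lambda>_. 0)) ?T = marker_matrix \<sigma> n [a]"
    using letter_rows[OF letters_less[OF a]]
    by (intro eq_matI) (auto simp: marker_matrix_def on_top_of_def)
  ultimately show ?thesis
    by simp
qed

text \<open>With \<open>n\<close> held fixed, a column depends only on its own letter. Appending
  strings therefore places their matrices side by side.\<close>

lemma marker_expands:
  "expands1 G N X \<Longrightarrow> N \<in> V \<Longrightarrow> expands2 marker_slp2 (4 * N + 3) (marker_matrix \<sigma> n X)"
proof (induction rule: expands1.induct)
  case (1 N a)
  then show ?case
    using marker_letter by blast
next
  case (2 N A B X Y)
  have "A \<in> V" "B \<in> V"
    using closed[OF 2(7)] 2(2) by auto
  then have "expands2 marker_slp2 (4 * N + 3) (left_of (marker_matrix \<sigma> n X) (marker_matrix \<sigma> n Y))"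
    using 2 marker_rule_simps(7)[OF 2(2)]
    by (intro expands2.intros(3)[of _ _ "4 * A + 3" "4 * B + 3"]) (auto simp: marker_slp2_def)
  moreover have "left_of (marker_matrix \<sigma> n X) (marker_matrix \<sigma> n Y) = marker_matrix \<sigma> n (X @ Y)"
    by (intro eq_matI) (auto simp: marker_matrix_def left_of_def nth_append)
  ultimately show ?case
    by simp
qed

section \<open>Size of the grammar\<close>

lemma card_heights:
  assumes "\<sigma> * n < 2 ^ Suc k"
  shows "card heights \<le> 1 + card V * (4 * k + 2)"
proof -
  have "card (halving_heights ((a + 1) * n) \<union> halving_heights ((\<sigma> - a) * n)) \<le> 4 * k + 2"
    if "a \<in> letters" for a
  proof -
    have "(a + 1) * n \<le> \<sigma> * n" "(\<sigma> - a) * n \<le> \<sigma> * n"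
      using letters_less[OF that] by (intro mult_le_mono1; simp)+
    then have "card (halving_heights ((a + 1) * n)) \<le> 2 * k + 1"
      "card (halving_heights ((\<sigma> - a) * n)) \<le> 2 * k + 1"
      using assms by (meson card_halving_heights le_less_trans)+
    then show ?thesis
      using card_Un_le[of "halving_heights ((a + 1) * n)" "halving_heights ((\<sigma> - a) * n)"] by linarith
  qed
  then have "(\<Sum>a\<in>letters. card (halving_heights ((a + 1) * n) \<union> halving_heights ((\<sigma> - a) * n)))
      \<le> of_nat (card letters) * (4 * k + 2)"
    by (rule sum_bounded_above)
  then have "card (\<Union>a\<in>letters. halving_heights ((a + 1) * n) \<union> halving_heights ((\<sigma> - a) * n))
      \<le> card letters * (4 * k + 2)"
    unfolding of_nat_id by (rule order_trans[OF card_UN_le[OF letters_card(1)]])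
  also have "\<dots> \<le> card V * (4 * k + 2)"
    using letters_card(2) by (rule mult_le_mono1)
  moreover have "card (insert 1 H) \<le> 1 + card H" for H :: "nat set"
    by (cases "finite H") (simp_all add: card_insert_if)
  ultimately show ?thesis
    unfolding heights_def by (meson add_left_mono order_trans)
qed

text \<open>Per element of \<open>V\<close> there are at most one letter with two halving chains,
  one tail and one coded nonterminal. The two literals are absorbed using
  \<open>card V >= 1\<close>, and right-hand sides have length at most 2.\<close>

lemma size_marker_slp2:
  assumes "\<sigma> * n < 2 ^ Suc k"
  shows "size2 marker_slp2 \<le> card V * (8 * k + 16)"
proof -
  have "nonterms2 marker_slp2 \<subseteq> {1, 4} \<union> (\<lambda>h. 4 * h) ` (heights - {1})
      \<union> (\<lambda>a. 4 * a + 2) ` letters \<union> (\<lambda>N. 4 * N + 3) ` V"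
    by (auto simp: nonterms2_def marker_slp2_def)
  then have "card (nonterms2 marker_slp2) \<le> card ({1, 4} \<union> (\<lambda>h. 4 * h) ` (heights - {1})
      \<union> (\<lambda>a. 4 * a + 2) ` letters \<union> (\<lambda>N. 4 * N + 3) ` V)"
    using finite_heights letters_card V(1) by (intro card_mono) auto
  also have "\<dots> \<le> card {1, 4::nat} + card ((\<lambda>h. 4 * h) ` (heights - {1}))
      + card ((\<lambda>a. 4 * a + 2) ` letters) + card ((\<lambda>N. 4 * N + 3) ` V)"
    by (intro card_Un_le[THEN order_trans] add_mono order_refl)
  also have "\<dots> \<le> 2 + (card heights - 1) + card V + card V"
  proof (intro add_mono)
    show "card ((\<lambda>h. 4 * h) ` (heights - {1})) \<le> card heights - 1"
    proof -
      have "1 \<in> heights"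
        by (simp add: heights_def)
      then show ?thesis
        using card_image_le[of "heights - {1}" "\<lambda>h. 4 * h"] finite_heights
          card_Diff_singleton[of 1 heights] by simp
    qed
    show "card ((\<lambda>a. 4 * a + 2) ` letters) \<le> card V"
      using card_image_le[OF letters_card(1)] letters_card(2) le_trans by blast
  qed (use card_image_le[OF V(1)] in auto)
  also have "\<dots> \<le> 2 + card V * (4 * k + 2) + card V + card V"
    using card_heights[OF assms] by simp
  also have "\<dots> \<le> card V * (4 * k + 6)"
  proof -
    have "1 \<le> card V"
      using V by (metis One_nat_def Suc_leI card_gt_0_iff empty_iff)
    then show ?thesis
      by (simp add: algebra_simps)
  qed
  finally have c: "card (nonterms2 marker_slp2) \<le> card V * (4 * k + 6)" .
  have "max (rhs_length r) 1 \<le> 2" for r :: "(nat, nat) rhs"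
    by (cases r) auto
  then have "size2 marker_slp2 \<le> card (nonterms2 marker_slp2) * 2"
    unfolding size2_def rules_size_def using sum_bounded_above[of "nonterms2 marker_slp2" _ 2]
    by (metis (no_types, lifting) of_nat_id)
  then show ?thesis
    using c by (simp add: algebra_simps)
qed

end

section \<open>Symbol occurrence by a single matrix query\<close>

definition occurs_between :: "nat list \<Rightarrow> nat \<Rightarrow> nat \<Rightarrow> nat \<Rightarrow> bool" where
  "occurs_between T b e c \<longleftrightarrow> (\<exists>j\<in>{b<..e}. T ! (j - 1) = c)"

text \<open>\<open>srcs\<close> lists the indices of the arguments in \<^const>\<open>call_values\<close>; the answer of the matrix query
  is compared with the \<open>k\<close>-th value, from above or below according to \<open>up\<close>.\<close>

definition call_correct :: "(nat mat \<Rightarrow> query_problem) \<Rightarrow> nat list \<Rightarrow> bool \<Rightarrow> nat \<Rightarrow> bool" where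
  "call_correct Q srcs up k \<longleftrightarrow>
     (\<forall>\<sigma> T b e c. (\<forall>a\<in>set T. a < \<sigma>) \<longrightarrow> b < e \<longrightarrow> e \<le> length T \<longrightarrow> c < \<sigma> \<longrightarrow>
        (let v = call_values (length T) b e c in
         \<exists>ans. (map (\<lambda>i. v ! i) srcs, ans) \<in> Q (marker_matrix \<sigma> (length T) T) \<and>
           (occurs_between T b e c \<longleftrightarrow> (if up then v ! k < ans else ans < v ! k))))"

section \<open>Entries and blocks at a marker row\<close>

locale marked_text =
  fixes \<sigma> :: nat and T :: "nat list" and b e c :: nat
  assumes T: "\<forall>a\<in>set T. a < \<sigma>" and be: "b < e" "e \<le> length T" and c: "c < \<sigma>"
begin

abbreviation "n \<equiv> length T"
abbreviation "M \<equiv> marker_matrix \<sigma> n T"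
abbreviation "R \<equiv> (c + 1) * n"

lemma dims: "dim_row M = (\<sigma> + 1) * n + 1" "dim_col M = n"
  by (simp_all add: marker_matrix_def)

lemma n_pos: "0 < n"
  using be by linarith

text \<open>Room for a square of any side up to \<open>n\<close> starting at the marker row of
  \<open>c\<close>; it rests on \<open>c + 2 <= \<sigma> + 1\<close>.\<close>

lemma R_bound: "R + n + 1 \<le> dim_row M"
proof -
  have "(c + 2) * n \<le> (\<sigma> + 1) * n"
    using c by (intro mult_le_mono1) simp
  then show ?thesis
    by (simp add: dims)
qed

text \<open>Ones occur only in rows whose 0-based index is a multiple of \<open>n\<close>; among
  \<open>n\<close> consecutive rows starting at the marker row of \<open>c\<close>, only the first
  qualifies.\<close>

lemma entry_marked_rows:
  assumes "y < n" "1 \<le> j" "j \<le> n"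
  shows "entry M (R + 1 + y) j = of_bool (y = 0 \<and> T ! (j - 1) = c)"
proof -
  have eq: "R + y = (a + 1) * n \<longleftrightarrow> y = 0 \<and> a = c" for a
  proof
    assume *: "R + y = (a + 1) * n"
    \<comment> \<open>Reduction modulo \<open>n\<close> removes both multiples of \<open>n\<close>
      and leaves \<open>y\<close>, which is smaller than \<open>n\<close>.\<close>
    have "y = 0"
      using arg_cong[OF *, of "\<lambda>x. x mod n"] assms(1) by (simp del: mult_Suc)
    then show "y = 0 \<and> a = c"
      using * n_pos by simp
  qed simp
  have "R + y < dim_row M" "j - 1 < n"
    using R_bound assms by linarith+
  then have "entry M (R + 1 + y) j = of_bool (R + y = (T ! (j - 1) + 1) * n)"
    by (simp add: entry_def marker_matrix_def)
  then show ?thesis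
    by (simp only: eq)
qed

lemma entry_top_rows:
  assumes "y < n" "1 \<le> j" "j \<le> n"
  shows "entry M (1 + y) j = 0"
proof -
  have "y < dim_row M" "j - 1 < n"
    using R_bound assms by linarith+
  then show ?thesis
    using assms(1) by (simp add: entry_def marker_matrix_def)
qed

text \<open>The height \<open>h\<close> is left open because \<open>h = 1\<close> serves the
  rectangle queries and \<open>h = e - b\<close> the square ones.\<close>

lemma all_zero_rows:
  assumes "1 \<le> h" "h \<le> n"
  shows "all_zero M R (R + h) b e \<longleftrightarrow> \<not> occurs_between T b e c"
proof
  assume *: "all_zero M R (R + h) b e"
  have "T ! (j - 1) \<noteq> c" if "j \<in> {b<..e}" for j
  proof -
    have "entry M (R + 1) j = 0"
      using * that assms(1) unfolding all_zero_def by auto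
    then show ?thesis
      using entry_marked_rows[of 0 j] n_pos that be by auto
  qed
  then show "\<not> occurs_between T b e c"
    by (auto simp: occurs_between_def)
next
  assume *: "\<not> occurs_between T b e c"
  show "all_zero M R (R + h) b e"
    unfolding all_zero_def
  proof clarify
    fix i j assume ij: "i \<in> {R<..R + h}" "j \<in> {b<..e}"
    then obtain y where y: "i = R + 1 + y" "y < n"
      using assms(2) that[of "i - R - 1"] by force
    show "entry M i j = 0"
      unfolding y(1) using entry_marked_rows[OF y(2), of j] * ij(2) be
      by (auto simp: occurs_between_def)
  qed
qed

lemma sum_row: "0 < (\<Sum>(i, j)\<in>{R<..R + 1} \<times> {b<..e}. entry M i j) \<longleftrightarrow> occurs_between T b e c"
proof -
  have "(\<Sum>(i, j)\<in>{R<..R + 1} \<times> {b<..e}. entry M i j) = 0 \<longleftrightarrow> all_zero M R (R + 1) b e"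
    by (subst sum_eq_0_iff) (auto simp: all_zero_def)
  also have "\<dots> \<longleftrightarrow> \<not> occurs_between T b e c"
    using all_zero_rows[of 1] n_pos by linarith
  finally show ?thesis
    by (metis gr0I less_irrefl)
qed

text \<open>The reference block lies in the zero rows at the top, so equality with it is a test for
  zeros. The height is open again: 1 for equality and line LCE, the side length for square
  LCE.\<close>

lemma blocks_equal:
  assumes "1 \<le> h" "h \<le> n" "b + l \<le> n"
  shows "block M (R + 1) h (b + 1) l = block M 1 h (b + 1) l \<longleftrightarrow> \<not> occurs_between T b (b + l) c"
proof
  assume eq: "block M (R + 1) h (b + 1) l = block M 1 h (b + 1) l"
  have "T ! (j - 1) \<noteq> c" if j: "j \<in> {b<..b + l}" for j
  proof -
    define y where "y = j - b - 1"
    have y: "y < l" "j = b + 1 + y"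
      using j by (auto simp: y_def)
    have "entry M (R + 1) j = entry M 1 j"
      using arg_cong[OF eq, of "\<lambda>X. X $$ (0, y)"] assms(1) y by (simp add: block_def)
    then show ?thesis
      using entry_marked_rows[of 0 j] entry_top_rows[of 0 j] n_pos assms(3) y by auto
  qed
  then show "\<not> occurs_between T b (b + l) c"
    by (auto simp: occurs_between_def)
next
  assume *: "\<not> occurs_between T b (b + l) c"
  show "block M (R + 1) h (b + 1) l = block M 1 h (b + 1) l"
  proof (rule eq_matI)
    fix i j assume "i < dim_row (block M 1 h (b + 1) l)" "j < dim_col (block M 1 h (b + 1) l)"
    then have ij: "i < h" "j < l"
      by (simp_all add: block_def)
    have "T ! (b + 1 + j - 1) \<noteq> c"
      using * ij(2) by (auto simp: occurs_between_def dest: bspec[of _ _ "b + 1 + j"])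
    then have "entry M (R + 1 + i) (b + 1 + j) = entry M (1 + i) (b + 1 + j)"
      using entry_marked_rows[of i "b + 1 + j"] entry_top_rows[of i "b + 1 + j"] ij assms by simp
    then show "block M (R + 1) h (b + 1) l $$ (i, j) = block M 1 h (b + 1) l $$ (i, j)"
      using ij by (simp add: block_def)
  qed (simp_all add: block_def)
qed

lemma occurs_between_mono: "occurs_between T b e c \<Longrightarrow> e \<le> e' \<Longrightarrow> occurs_between T b e' c"
  by (auto simp: occurs_between_def)

text \<open>Common core of both LCE queries, with \<open>S\<close> the set of feasible extensions.
  If \<open>c\<close> occurs in (b..e], it occurs in every longer interval from \<open>b\<close>, so
  no extension reaches \<open>e - b\<close>; otherwise \<open>e - b\<close> itself is
  feasible.\<close>

lemma Max_less_iff_occurs: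
  assumes "finite S" "0 \<in> S"
    and "\<And>t. 1 \<le> t \<Longrightarrow> t \<in> S \<longleftrightarrow> b + t \<le> n \<and> \<not> occurs_between T b (b + t) c"
  shows "Max S < e - b \<longleftrightarrow> occurs_between T b e c"
proof
  assume "Max S < e - b"
  then have "e - b \<notin> S"
    using assms(1) Max_ge leD by blast
  then show "occurs_between T b e c"
    using assms(3)[of "e - b"] be by simp
next
  assume *: "occurs_between T b e c"
  have "t < e - b" if t: "t \<in> S" for t
  proof (rule ccontr)
    assume "\<not> t < e - b"
    then have "1 \<le> t" "e \<le> b + t"
      using be by auto
    then show False
      using assms(3)[of t] t occurs_between_mono[OF *] by blast
  qed
  then show "Max S < e - b"
    using assms(1,2) by (subst Max_less_iff) auto
qed

lemma square_lce_iff: "square_lce M (R + 1) 1 (b + 1) (b + 1) < e - b \<longleftrightarrow> occurs_between T b e c"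
  unfolding square_lce_def
proof (rule Max_less_iff_occurs)
  show "finite {t. max (R + 1) 1 + t \<le> dim_row M + 1 \<and> max (b + 1) (b + 1) + t \<le> dim_col M + 1 \<and>
      block M (R + 1) t (b + 1) t = block M 1 t (b + 1) t}"
    by (rule finite_subset[of _ "{..dim_col M + 1}"]) auto
  show "0 \<in> {t. max (R + 1) 1 + t \<le> dim_row M + 1 \<and> max (b + 1) (b + 1) + t \<le> dim_col M + 1 \<and>
      block M (R + 1) t (b + 1) t = block M 1 t (b + 1) t}"
    using R_bound be by (auto simp: dims block_def)
next
  fix t :: nat assume t: "1 \<le> t"
  show "t \<in> {t. max (R + 1) 1 + t \<le> dim_row M + 1 \<and> max (b + 1) (b + 1) + t \<le> dim_col M + 1 \<and>
      block M (R + 1) t (b + 1) t = block M 1 t (b + 1) t} \<longleftrightarrow> b + t \<le> n \<and> \<not> occurs_between T b (b + t) c"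
    (is "_ \<in> {t. ?A t \<and> ?B t \<and> ?C t} \<longleftrightarrow> _")
  proof -
    have B: "?B t \<longleftrightarrow> b + t \<le> n"
      by (simp add: dims)
    \<comment> \<open>The columns run out before the rows do, so the row condition follows from the
      column condition.\<close>
    have A: "?A t" if "b + t \<le> n"
      using R_bound that by linarith
    have C: "?C t \<longleftrightarrow> \<not> occurs_between T b (b + t) c" if "b + t \<le> n"
      using blocks_equal[OF t _ that] that by simp
    show ?thesis
      using A B C by blast
  qed
qed

lemma line_lce_iff: "line_lce M (R + 1) 1 (b + 1) (b + 1) 1 < e - b \<longleftrightarrow> occurs_between T b e c"
  unfolding line_lce_def
proof (rule Max_less_iff_occurs)
  show "finite {t. max (b + 1) (b + 1) + t \<le> dim_col M + 1 \<and>
      block M (R + 1) 1 (b + 1) t = block M 1 1 (b + 1) t}"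
    by (rule finite_subset[of _ "{..dim_col M + 1}"]) auto
  show "0 \<in> {t. max (b + 1) (b + 1) + t \<le> dim_col M + 1 \<and>
      block M (R + 1) 1 (b + 1) t = block M 1 1 (b + 1) t}"
    using be by (auto simp: dims block_def)
next
  fix t :: nat assume "1 \<le> t"
  have "block M (R + 1) 1 (b + 1) t = block M 1 1 (b + 1) t \<longleftrightarrow> \<not> occurs_between T b (b + t) c" if "b + t \<le> n"
    using blocks_equal[OF _ _ that, of 1] n_pos by simp
  moreover have "max (b + 1) (b + 1) + t \<le> dim_col M + 1 \<longleftrightarrow> b + t \<le> n"
    by (simp add: dims)
  ultimately show "t \<in> {t. max (b + 1) (b + 1) + t \<le> dim_col M + 1 \<and>
      block M (R + 1) 1 (b + 1) t = block M 1 1 (b + 1) t} \<longleftrightarrow> b + t \<le> n \<and> \<not> occurs_between T b (b + t) c"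
    by blast
qed

lemma call_value_nth:
  "call_values n b e c ! 0 = 1" "call_values n b e c ! 1 = 0" "call_values n b e c ! 2 = b"
  "call_values n b e c ! 3 = e" "call_values n b e c ! 4 = R" "call_values n b e c ! 5 = R + 1"
  "call_values n b e c ! 6 = b + 1" "call_values n b e c ! 7 = e - b"
  "call_values n b e c ! 8 = R + (e - b)"
  by (simp_all add: call_values_def)

lemma bounds:
  "R \<le> dim_row M" "R + 1 \<le> dim_row M" "R + 1 \<ge> 1" "R + (e - b) \<le> dim_row M" "1 \<le> dim_row M"
  "b \<le> dim_col M" "e \<le> dim_col M" "1 \<le> dim_col M" "b + 1 \<le> dim_col M" "e - b \<le> dim_col M" "1 \<le> e - b"
  "b + 1 + (e - b) \<le> dim_col M + 1"
  using R_bound be n_pos unfolding dims by linarith+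

end

section \<open>The six query types, each used once\<close>

lemma call_correctI:
  assumes "\<And>\<sigma> T b e c. marked_text \<sigma> T b e c \<Longrightarrow>
     \<exists>ans. (map (\<lambda>i. call_values (length T) b e c ! i) srcs, ans) \<in> Q (marker_matrix \<sigma> (length T) T) \<and>
       (occurs_between T b e c \<longleftrightarrow>
          (if up then call_values (length T) b e c ! k < ans else ans < call_values (length T) b e c ! k))"
  shows "call_correct Q srcs up k"
  using assms unfolding call_correct_def marked_text_def Let_def by blast

text \<open>The indices select the single row (R..R+1] and the columns (b..e]; the sum is compared
  with 0 from above.\<close>

lemma call_correct_sum: "call_correct sum_queries [4, 5, 2, 3] True 1"
proof (rule call_correctI)
  fix \<sigma> T b e c assume "marked_text \<sigma> T b e c"
  then interpret marked_text \<sigma> T b e c .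
  have "([R, R + 1, b, e], \<Sum>(i, j)\<in>{R<..R + 1} \<times> {b<..e}. entry M i j) \<in> sum_queries M"
    unfolding sum_queries_def by (intro CollectI exI conjI, rule refl) (use bounds in simp_all)
  then show "\<exists>ans. (map (\<lambda>i. call_values n b e c ! i) [4, 5, 2, 3], ans) \<in> sum_queries M \<and>
       (occurs_between T b e c \<longleftrightarrow>
          (if True then call_values n b e c ! 1 < ans else ans < call_values n b e c ! 1))"
    unfolding list.map call_value_nth using sum_row by (metis (full_types))
qed

lemma call_correct_all_zero: "call_correct all_zero_queries [4, 5, 2, 3] False 0"
proof (rule call_correctI)
  fix \<sigma> T b e c assume "marked_text \<sigma> T b e c"
  then interpret marked_text \<sigma> T b e c .
  have m: "([R, R + 1, b, e], of_bool (all_zero M R (R + 1) b e)) \<in> all_zero_queries M"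
    unfolding all_zero_queries_def by (intro CollectI exI conjI, rule refl) (use bounds in simp_all)
  show "\<exists>ans. (map (\<lambda>i. call_values n b e c ! i) [4, 5, 2, 3], ans) \<in> all_zero_queries M \<and>
       (occurs_between T b e c \<longleftrightarrow>
          (if False then call_values n b e c ! 0 < ans else ans < call_values n b e c ! 0))"
    unfolding list.map call_value_nth if_False
    by (rule exI, rule conjI, rule m) (use all_zero_rows[of 1] n_pos in simp)
qed

text \<open>The square has side \<open>e - b\<close> and lower right corner
  \<open>(R + (e - b), e)\<close>; below the marker row it meets only zeros. The answer is tested
  for being less than 1.\<close>

lemma call_correct_square_all_zero: "call_correct square_all_zero_queries [7, 8, 3] False 0"
proof (rule call_correctI)
  fix \<sigma> T b e c assume "marked_text \<sigma> T b e c"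
  then interpret marked_text \<sigma> T b e c .
  have m: "([e - b, R + (e - b), e],
      of_bool (all_zero M (R + (e - b) - (e - b)) (R + (e - b)) (e - (e - b)) e)) \<in> square_all_zero_queries M"
    unfolding square_all_zero_queries_def by (intro CollectI exI conjI, rule refl) (use bounds in simp_all)
  show "\<exists>ans. (map (\<lambda>i. call_values n b e c ! i) [7, 8, 3], ans) \<in> square_all_zero_queries M \<and>
       (occurs_between T b e c \<longleftrightarrow>
          (if False then call_values n b e c ! 0 < ans else ans < call_values n b e c ! 0))"
    unfolding list.map call_value_nth if_False
    by (rule exI, rule conjI, rule m) (use all_zero_rows[of "e - b"] be in simp)
qed

text \<open>The part of the marker row in the columns (b..e] is compared with the same columns of
  row 1.\<close>

lemma call_correct_equality: "call_correct equality_queries [5, 0, 0, 6, 6, 7] False 0"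
proof (rule call_correctI)
  fix \<sigma> T b e c assume "marked_text \<sigma> T b e c"
  then interpret marked_text \<sigma> T b e c .
  have m: "([R + 1, 1, 1, b + 1, b + 1, e - b],
      of_bool (block M (R + 1) 1 (b + 1) (e - b) = block M 1 1 (b + 1) (e - b))) \<in> equality_queries M"
    unfolding equality_queries_def by (intro CollectI exI conjI, rule refl) (use bounds in simp_all)
  show "\<exists>ans. (map (\<lambda>i. call_values n b e c ! i) [5, 0, 0, 6, 6, 7], ans) \<in> equality_queries M \<and>
       (occurs_between T b e c \<longleftrightarrow>
          (if False then call_values n b e c ! 0 < ans else ans < call_values n b e c ! 0))"
    unfolding list.map call_value_nth if_False
    by (rule exI, rule conjI, rule m) (use blocks_equal[of 1 "e - b"] be n_pos in simp)
qed

text \<open>Index 7 is \<open>e - b\<close>: a shorter common extension of marker row and top row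
  means that a 1 was met.\<close>

lemma call_correct_square_lce: "call_correct square_lce_queries [5, 0, 6, 6] False 7"
proof (rule call_correctI)
  fix \<sigma> T b e c assume "marked_text \<sigma> T b e c"
  then interpret marked_text \<sigma> T b e c .
  have "([R + 1, 1, b + 1, b + 1], square_lce M (R + 1) 1 (b + 1) (b + 1)) \<in> square_lce_queries M"
    unfolding square_lce_queries_def by (intro CollectI exI conjI, rule refl) (use bounds in simp_all)
  then show "\<exists>ans. (map (\<lambda>i. call_values n b e c ! i) [5, 0, 6, 6], ans) \<in> square_lce_queries M \<and>
       (occurs_between T b e c \<longleftrightarrow>
          (if False then call_values n b e c ! 7 < ans else ans < call_values n b e c ! 7))"
    unfolding list.map call_value_nth if_False
    using square_lce_iff by blast
qed

lemma call_correct_line_lce: "call_correct line_lce_queries [5, 0, 6, 6, 0] False 7"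
proof (rule call_correctI)
  fix \<sigma> T b e c assume "marked_text \<sigma> T b e c"
  then interpret marked_text \<sigma> T b e c .
  have "([R + 1, 1, b + 1, b + 1, 1], line_lce M (R + 1) 1 (b + 1) (b + 1) 1) \<in> line_lce_queries M"
    unfolding line_lce_queries_def by (intro CollectI exI conjI, rule refl) (use bounds in simp_all)
  then show "\<exists>ans. (map (\<lambda>i. call_values n b e c ! i) [5, 0, 6, 6, 0], ans) \<in> line_lce_queries M \<and>
       (occurs_between T b e c \<longleftrightarrow>
          (if False then call_values n b e c ! 7 < ans else ans < call_values n b e c ! 7))"
    unfolding list.map call_value_nth if_False
    using line_lce_iff by blast
qed

section \<open>Asymptotic bounds\<close>

lemma lg_ge_1: "1 \<le> n \<Longrightarrow> 1 \<le> lg n"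
  by (simp add: lg_def le_log_iff)

lemma lg_le_self: "lg n \<le> n"
proof -
  have "real (n + 1) \<le> 2 ^ n"
    by (metis less_exp Suc_eq_plus1 Suc_leI of_nat_le_iff of_nat_numeral of_nat_power)
  then have "log 2 (real n + 1) \<le> log 2 (2 ^ n)"
    by (intro log_mono) auto
  then show ?thesis
    by (simp add: lg_def)
qed

lemma two_powr_lg: "2 powr lg n = real n + 1"
  by (simp add: lg_def)

lemma lg_le_of_power_bound:
  assumes "m + 1 \<le> (n + 1) ^ k"
  shows "lg m \<le> k * lg n"
proof -
  have "real m + 1 \<le> (real n + 1) ^ k"
    using of_nat_mono[OF assms, where 'a = real] by (simp add: add.commute)
  then have "log 2 (real m + 1) \<le> log 2 ((real n + 1) ^ k)"
    by (intro log_mono) auto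
  also have "\<dots> = k * log 2 (real n + 1)"
    by (simp add: log_nat_power)
  finally show ?thesis
    by (simp add: lg_def)
qed

lemma power_le_word_size:
  assumes "real w \<ge> real m * lg n"
  shows "(n + 1) ^ m \<le> 2 ^ w"
proof -
  have "(real n + 1) ^ m = 2 powr (lg n * m)"
    by (simp add: two_powr_lg powr_powr[symmetric] powr_realpow)
  also have "\<dots> \<le> 2 powr w"
    using assms by (simp add: mult.commute)
  also have "\<dots> = 2 ^ w"
    by (simp add: powr_realpow)
  finally have "real ((n + 1) ^ m) \<le> real (2 ^ w)"
    by (simp add: add.commute)
  then show ?thesis
    unfolding of_nat_le_iff .
qed

text \<open>Used to absorb constant factors into the exponent of \<open>n + 1\<close>, which turns
  polynomial bounds into requirements on the word size.\<close>

lemma less_Suc_power_self: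
  fixes k n :: nat
  assumes "1 \<le> n"
  shows "k < (n + 1) ^ k"
proof -
  have "(2::nat) ^ k \<le> (n + 1) ^ k"
    using assms by (intro power_mono) auto
  then show ?thesis
    using less_exp[of k] by linarith
qed

text \<open>The product is at most \<open>(A + 3) * (n + 1) ^ (d + 1)\<close>, and the factor
  \<open>A + 3\<close> is absorbed as \<open>(n + 1) ^ (A + 3)\<close>.\<close>

lemma marker_rows_bound:
  assumes "1 \<le> n" "\<sigma> \<le> A * n ^ d"
  shows "(\<sigma> + 1) * n + 2 \<le> (n + 1) ^ (A + d + 4)"
proof -
  let ?B = "n + 1"
  have "\<sigma> \<le> A * ?B ^ d"
    using assms(2) by (rule order_trans) (intro mult_le_mono2 power_mono; simp)
  then have "(\<sigma> + 1) * n \<le> (A * ?B ^ d + 1) * ?B"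
    by (intro mult_le_mono) auto
  also have "\<dots> = A * ?B ^ (d + 1) + ?B"
    by (simp add: algebra_simps)
  also have "\<dots> \<le> A * ?B ^ (d + 1) + ?B ^ (d + 1)"
    by (intro add_left_mono self_le_power) auto
  finally have "(\<sigma> + 1) * n \<le> (A + 1) * ?B ^ (d + 1)"
    by (simp only: add_mult_distrib mult_1)
  moreover have "2 \<le> 2 * ?B ^ (d + 1)"
    using one_le_power[of ?B "d + 1"] by linarith
  ultimately have "(\<sigma> + 1) * n + 2 \<le> (A + 3) * ?B ^ (d + 1)"
    unfolding add_mult_distrib by linarith
  also have "\<dots> \<le> ?B ^ (A + 3) * ?B ^ (d + 1)"
    using less_Suc_power_self[OF assms(1), of "A + 3"] by (intro mult_le_mono1) simp
  also have "\<dots> = ?B ^ (A + d + 4)"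
    unfolding power_add[symmetric] by (rule arg_cong[where f = "\<lambda>k. ?B ^ k"]) simp
  finally show ?thesis .
qed

lemma expands1_letters:
  "expands1 G N X \<Longrightarrow> a \<in> set X \<Longrightarrow> \<exists>M\<in>nonterms1 G. rule1 G M = Lit a"
  by (induction rule: expands1.induct) auto

lemma card_le_size1: "finite (nonterms1 G) \<Longrightarrow> card (nonterms1 G) \<le> size1 G"
  unfolding size1_def rules_size_def card_eq_sum by (intro sum_mono) auto

text \<open>Here \<open>m\<close> is the number of nonterminals kept by trimming. The bound by
  \<open>size1 G\<close> yields the claimed size, the bound by \<open>2 * n\<close> makes the data
  structure fit into memory.\<close>

lemma marker_grammar_exists:
  fixes G :: "(nat, nat) slp1"
  assumes G: "is_slp1 G" "alphabet1 G = {0..<\<sigma>}" "represents1 G T"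
    and n: "n = length T" and \<sigma>: "\<sigma> \<le> A * n ^ d"
  obtains G2 :: "(nat, nat) slp2" and m :: nat
  where "is_slp2 G2" "alphabet2 G2 = {0, 1}" "represents2 G2 (marker_matrix \<sigma> n T)"
    "real (size2 G2) \<le> m * (8 * (A + d + 4) + 16) * lg n" "1 \<le> m" "m \<le> size1 G" "m \<le> 2 * n"
proof -
  let ?c = "A + d + 4"
  have T: "expands1 G (start1 G) T"
    using G(3) by (simp add: represents1_def)
  then have n1: "1 \<le> n"
    using expands1_nonempty[OF T] n by (cases T) auto
  obtain V where trim: "finite V" "start1 G \<in> V" "V \<subseteq> nonterms1 G" "card V < 2 * length T"
    "\<And>M. M \<in> V \<Longrightarrow> rhs_nonterms (rule1 G M) \<subseteq> V" "\<And>M. M \<in> V \<Longrightarrow> \<exists>Y. expands1 G M Y"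
    using expands1_trim[OF T] by metis
  have less: "a < \<sigma>" if "M \<in> V" "rule1 G M = Lit a" for M a
  proof -
    have "M \<in> nonterms1 G"
      using that trim by blast
    then have "a \<in> alphabet1 G"
      using G(1) that(2) unfolding is_slp1_def by force
    then show ?thesis
      using G(2) by simp
  qed
  interpret marker_grammar G V \<sigma> n
    using trim n1 less by unfold_locales auto
  define H where "H = (\<sigma> + 1) * n + 1"
  have "H + 1 \<le> (n + 1) ^ ?c"
    using marker_rows_bound[OF n1 \<sigma>] by (simp add: H_def)
  then have lgH: "lg H \<le> ?c * lg n"
    by (rule lg_le_of_power_bound)
  \<comment> \<open>The binary length of the row count, chosen so that \<open>H < 2 ^ Suc k\<close>
    bounds all halving chains while \<open>k\<close> is at most \<open>lg H\<close>.\<close>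
  define k where "k = nat \<lfloor>log 2 H\<rfloor>"
  have H1: "1 \<le> H"
    by (simp add: H_def)
  have log0: "0 \<le> log 2 H"
    using H1 by simp
  have "log 2 H < Suc k"
    unfolding k_def using log0 by linarith
  then have "real H < 2 powr Suc k"
    using H1 by (subst (asm) log_less_iff) auto
  then have "real H < real (2 ^ Suc k)"
    by (simp add: powr_realpow[symmetric] powr_add)
  then have "\<sigma> * n < 2 ^ Suc k"
    unfolding of_nat_less_iff by (simp add: H_def)
  then have sz: "size2 marker_slp2 \<le> card V * (8 * k + 16)"
    by (rule size_marker_slp2)
  have "real k \<le> log 2 H"
    unfolding k_def using log0 by linarith
  also have "\<dots> \<le> lg H"
    unfolding lg_def using H1 by (intro log_mono) auto
  finally have "8 * real k + 16 \<le> 8 * (?c * lg n) + 16 * lg n"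
    using lgH lg_ge_1[OF n1] by linarith
  then have "real (card V) * (8 * real k + 16) \<le> real (card V) * (8 * (?c * lg n) + 16 * lg n)"
    by (intro mult_left_mono) auto
  moreover have "real (size2 marker_slp2) \<le> real (card V) * (8 * real k + 16)"
    using of_nat_mono[OF sz, where 'a = real] by simp
  ultimately have "real (size2 marker_slp2) \<le> card V * (8 * ?c + 16) * lg n"
    by (simp add: algebra_simps)
  moreover have "represents2 marker_slp2 (marker_matrix \<sigma> n T)"
    using marker_expands[OF T trim(2)] by (simp add: represents2_def marker_slp2_def)
  moreover have "alphabet2 marker_slp2 = {0, 1}"
    by (simp add: marker_slp2_def)
  moreover have "1 \<le> card V"
    using trim by (metis One_nat_def Suc_leI card_gt_0_iff empty_iff)
  moreover have "card V \<le> size1 G"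
    using card_le_size1[of G] card_mono[OF _ trim(3)] G(1) unfolding is_slp1_def by linarith
  ultimately show thesis
    using that is_slp2_marker trim(4) n by (meson less_imp_le)
qed

text \<open>The stored data are \<open>n\<close> followed by the given structure for the marker
  matrix. Since the row count is polynomial in \<open>n\<close>, replacing its logarithm by
  \<open>lg n\<close> costs constant factors only.\<close>

lemma has_slp1_data_structure_via_call:
  assumes "has_slp2_data_structure Q" and call: "call_correct Q srcs up k"
    and srcs: "3 \<le> length srcs" "length srcs \<le> 6" "\<forall>i\<in>set srcs. i < 9" and k: "k < 9"
  shows "has_slp1_data_structure symbol_occurrence_queries"
  unfolding has_slp1_data_structure_def
proof (intro allI)
  fix A d :: nat
  obtain P \<kappa> Cs ks Ct kt where P: "\<And>(G :: (nat, nat) slp2) T n w.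
      is_slp2 G \<Longrightarrow> alphabet2 G = {0, 1} \<Longrightarrow> represents2 G T \<Longrightarrow> n = max (dim_row T) (dim_col T) \<Longrightarrow>
      real w \<ge> real \<kappa> * lg n \<Longrightarrow>
      \<exists>D. real (length D) \<le> real Cs * real (size2 G) * lg n ^ ks \<and>
          answers_queries w P D (real Ct * lg n ^ kt) (Q T)"
    using assms(1) unfolding has_slp2_data_structure_def by blast
  obtain F where F: "6 \<le> F" "\<forall>i\<in>set P. \<forall>r\<in>instr_regs i. r < F"
    using register_bound_exists by blast
  \<comment> \<open>\<open>c0\<close> satisfies \<open>lg H <= c0 * lg n\<close> for the row count
    \<open>H\<close>. \<open>K\<close> collects the constants from the given structure, the grammar
    size and this change of logarithm.\<close>
  define c0 where "c0 = A + d + 4"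
  define K where "K = Cs * (8 * c0 + 16) * c0 ^ ks"
  let ?P = "reduction_program F srcs up k P"
  \<comment> \<open>The three summands ensure, in turn, the word size demanded for the matrix,
    \<open>H < 2 ^ w\<close>, and \<open>length D < 2 ^ w\<close>.\<close>
  let ?\<kappa> = "\<kappa> * c0 + c0 + (K + ks + 4)"
  let ?Ct = "2 * Ct * c0 ^ kt + 22"
  show "\<exists>P (\<kappa>::nat) (Cs::nat) (ks::nat) (Ct::nat) (kt::nat).
        \<forall>(G :: (nat, nat) slp1) T n \<sigma> w.
          is_slp1 G \<and> alphabet1 G = {0..<\<sigma>} \<and> represents1 G T \<and>
          n = length T \<and> \<sigma> \<le> A * n ^ d \<and> real w \<ge> real \<kappa> * lg n \<longrightarrow>
          (\<exists>D. real (length D) \<le> real Cs * real (size1 G) * lg n ^ ks \<and>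
               answers_queries w P D (real Ct * lg n ^ kt) (symbol_occurrence_queries {0..<\<sigma>} T))"
  \<comment> \<open>\<open>K + 1\<close> pays for the additional cell holding \<open>n\<close>, and
    \<open>ks + 1\<close> for the logarithmic factor of the grammar.\<close>
  proof (rule exI[of _ ?P], rule exI[of _ ?\<kappa>], rule exI[of _ "K + 1"], rule exI[of _ "ks + 1"],
      rule exI[of _ ?Ct], rule exI[of _ kt], intro allI impI, elim conjE)
    fix G :: "(nat, nat) slp1" and T n \<sigma> w
    assume G: "is_slp1 G" "alphabet1 G = {0..<\<sigma>}" "represents1 G T"
      and n: "n = length T" and \<sigma>: "\<sigma> \<le> A * n ^ d" and w: "real w \<ge> real ?\<kappa> * lg n"
    have n1: "1 \<le> n"
      using expands1_nonempty[OF G(3)[unfolded represents1_def]] n by (cases T) auto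
    define L where "L = lg n"
    have L: "1 \<le> L" "L \<le> n"
      using lg_ge_1[OF n1] lg_le_self by (auto simp: L_def)
    define H where "H = (\<sigma> + 1) * n + 1"
    let ?M = "marker_matrix \<sigma> n T"
    have dims: "dim_row ?M = H" "dim_col ?M = n"
      by (simp_all add: marker_matrix_def H_def n)
    have "n \<le> H"
      by (simp add: H_def)
    then have maxH: "H = max (dim_row ?M) (dim_col ?M)"
      by (simp add: dims)
    have Hn: "H + 1 \<le> (n + 1) ^ c0"
      using marker_rows_bound[OF n1 \<sigma>] by (simp add: H_def c0_def)
    then have lgH: "lg H \<le> c0 * L"
      unfolding L_def by (rule lg_le_of_power_bound)
    have lgH0: "0 \<le> lg H"
      by (simp add: lg_def)
    have w_split: "real w \<ge> \<kappa> * (c0 * L)" "real w \<ge> c0 * L" "real w \<ge> (K + ks + 4) * L"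
    proof -
      have "real ?\<kappa> * L = \<kappa> * (c0 * L) + c0 * L + (K + ks + 4) * L"
        by (simp add: algebra_simps)
      moreover have "0 \<le> \<kappa> * (c0 * L)" "0 \<le> c0 * L" "0 \<le> (K + ks + 4) * L"
        using L by simp_all
      ultimately show "real w \<ge> \<kappa> * (c0 * L)" "real w \<ge> c0 * L" "real w \<ge> (K + ks + 4) * L"
        using w unfolding L_def by linarith+
    qed
    have H_less: "H < 2 ^ w"
      using Hn power_le_word_size[OF w_split(2)[unfolded L_def]] by linarith
    obtain G2 :: "(nat, nat) slp2" and m :: nat where
      G2: "is_slp2 G2" "alphabet2 G2 = {0, 1}" "represents2 G2 ?M"
      and sz: "real (size2 G2) \<le> m * (8 * c0 + 16) * L"
      and m: "1 \<le> m" "m \<le> size1 G" "m \<le> 2 * n"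
      using marker_grammar_exists[OF G n \<sigma>] unfolding c0_def L_def by metis
    have "real \<kappa> * lg H \<le> w"
      using mult_left_mono[OF lgH, of "real \<kappa>"] w_split(1) by linarith
    from P[OF G2 maxH this] obtain D where
      D: "real (length D) \<le> real Cs * real (size2 G2) * lg H ^ ks"
        "answers_queries w P D (real Ct * lg H ^ kt) (Q ?M)"
      by blast
    have lgHp: "lg H ^ j \<le> c0 ^ j * L ^ j" for j
      using power_mono[OF lgH lgH0, of j] by (simp add: power_mult_distrib)
    have len: "real (length D) \<le> K * m * L ^ (ks + 1)"
    proof -
      have "real Cs * real (size2 G2) * lg H ^ ks \<le> real Cs * (m * (8 * c0 + 16) * L) * (c0 ^ ks * L ^ ks)"
        using sz lgHp[of ks] lgH0 L by (intro mult_mono) auto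
      also have "\<dots> = K * m * L ^ (ks + 1)"
        by (simp add: K_def algebra_simps)
      finally show ?thesis
        using D(1) by linarith
    qed
    have lenD: "length D < 2 ^ w"
    proof -
      \<comment> \<open>From \<open>m <= 2 * n\<close> and \<open>L <= n\<close> the length becomes
        polynomial in \<open>n\<close>, and hence smaller than the power of \<open>n + 1\<close>
        that the word size admits.\<close>
      have "K * m * L ^ (ks + 1) \<le> K * (2 * n) * real n ^ (ks + 1)"
        using L m(3) by (intro mult_mono power_mono) (auto simp flip: of_nat_mult)
      then have "real (length D) \<le> real (K * (2 * n) * n ^ (ks + 1))"
        using len by simp
      then have "length D \<le> K * (2 * n) * n ^ (ks + 1)"
        unfolding of_nat_le_iff .
      also have "\<dots> \<le> (n + 1) ^ K * ((n + 1) * (n + 1)) * (n + 1) ^ (ks + 1)"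
        using less_Suc_power_self[OF n1, of K] n1 by (intro mult_le_mono power_mono) auto
      also have "\<dots> = (n + 1) ^ (K + ks + 3)"
        by (simp only: power_add power3_eq_cube power_one_right mult.assoc mult.left_commute mult.commute)
      also have "\<dots> < (n + 1) ^ (K + ks + 4)"
        using n1 by (intro power_strict_increasing) auto
      also have "\<dots> \<le> 2 ^ w"
        using w_split(3) by (intro power_le_word_size) (simp add: L_def)
      finally show ?thesis .
    qed
    have time: "2 * (real Ct * lg H ^ kt) + 22 \<le> real ?Ct * lg n ^ kt"
    proof -
      have "Ct * lg H ^ kt \<le> Ct * (c0 ^ kt * L ^ kt)"
        using lgHp[of kt] by (intro mult_left_mono) auto
      moreover have "1 \<le> L ^ kt"
        using L by simp
      moreover have "real ?Ct * L ^ kt = 2 * (Ct * (c0 ^ kt * L ^ kt)) + 22 * L ^ kt"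
        by (simp add: algebra_simps)
      ultimately show ?thesis
        unfolding L_def[symmetric] by linarith
    qed
    have T\<sigma>: "\<forall>a\<in>set T. a < \<sigma>"
    proof
      fix a assume "a \<in> set T"
      then obtain N where "N \<in> nonterms1 G" "rule1 G N = Lit a"
        using G(3) expands1_letters unfolding represents1_def by metis
      then have "a \<in> alphabet1 G"
        using G(1) unfolding is_slp1_def by force
      then show "a < \<sigma>"
        using G(2) by simp
    qed
    show "\<exists>D. real (length D) \<le> real (K + 1) * real (size1 G) * lg n ^ (ks + 1) \<and>
        answers_queries w ?P D (real ?Ct * lg n ^ kt) (symbol_occurrence_queries {0..<\<sigma>} T)"
    proof (intro exI conjI)
      have "K * m * L ^ (ks + 1) \<le> K * size1 G * L ^ (ks + 1)"
        using m L by (intro mult_right_mono) (auto intro!: mult_left_mono)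
      moreover have "1 \<le> size1 G * L ^ (ks + 1)"
      proof -
        have "1 \<le> L ^ (ks + 1)" "1 \<le> real (size1 G)"
          using L m by (auto simp del: power_Suc)
        then show ?thesis
          using mult_mono[of 1 "real (size1 G)" 1 "L ^ (ks + 1)"] by simp
      qed
      ultimately show "real (length (n # D)) \<le> real (K + 1) * real (size1 G) * lg n ^ (ks + 1)"
        using len unfolding L_def[symmetric] by (simp add: algebra_simps)
      show "answers_queries w ?P (n # D) (real ?Ct * lg n ^ kt) (symbol_occurrence_queries {0..<\<sigma>} T)"
        unfolding answers_queries_def
      proof (intro conjI ballI)
        fix x assume "x \<in> set (n # D)"
        then show "x < 2 ^ w"
          using D(2) H_less \<open>n \<le> H\<close> unfolding answers_queries_def by auto
      next
        fix q assume "q \<in> symbol_occurrence_queries {0..<\<sigma>} T"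
        then obtain b e c where q: "q = ([b, e, c], of_bool (occurs_between T b e c))"
          and bec: "b \<le> n" "e \<le> n" "c < \<sigma>"
          unfolding symbol_occurrence_queries_def occurs_between_def n by auto
        define v where "v = (if b < e then call_values n b e c else call_values n 0 1 c)"
        define args where "args = map (\<lambda>i. v ! i) srcs"
        have "\<exists>ans. (args, ans) \<in> Q ?M \<and>
            (b < e \<longrightarrow> (occurs_between T b e c \<longleftrightarrow> (if up then v ! k < ans else ans < v ! k)))"
        proof (cases "b < e")
          case True
          then show ?thesis
            using call[unfolded call_correct_def Let_def, rule_format, of T \<sigma> b e c] T\<sigma> bec
            unfolding args_def v_def n by simp
        next
          case False
          \<comment> \<open>The dummy interval is valid because \<open>T\<close> is nonempty. It
            only ensures that the given algorithm receives an admissible query and halts in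
            time.\<close>
          have "\<exists>ans. (map (\<lambda>i. call_values n 0 1 c ! i) srcs, ans) \<in> Q ?M"
            using call[unfolded call_correct_def Let_def, rule_format, of T \<sigma> 0 1 c] T\<sigma> bec n n1
            by auto
          then show ?thesis
            using False unfolding args_def v_def by auto
        qed
        then obtain ans where ans: "(args, ans) \<in> Q ?M"
          "b < e \<longrightarrow> (occurs_between T b e c \<longleftrightarrow> (if up then v ! k < ans else ans < v ! k))"
          by blast
        obtain t where t: "real t \<le> Ct * lg H ^ kt"
          "halted P ((step w P ^^ t) (initial_config D args))"
          "regs ((step w P ^^ t) (initial_config D args)) 0 = ans"
          using bspec[OF conjunct2[OF D(2)[unfolded answers_queries_def]] ans(1)]
          by (auto simp only: prod.case Let_def)
        have cH: "(c + 2) * n + 1 < 2 ^ w"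
        proof -
          have "(c + 2) * n \<le> (\<sigma> + 1) * n"
            using bec by (intro mult_le_mono1) simp
          then show ?thesis
            using H_less unfolding H_def by linarith
        qed
        have Dw: "\<forall>x\<in>set D. x < 2 ^ w"
          using D(2) by (simp add: answers_queries_def)
        obtain t' where t': "t' \<le> 2 * t + 22"
          "let s = (step w ?P ^^ t') (initial_config (n # D) [b, e, c])
           in halted ?P s \<and> regs s 0 = of_bool (b < e \<and> (if up then v ! k < ans else ans < v ! k))"
          using reduction_program_run[OF F(2,1) srcs k n1 bec(1,2) cH Dw lenD
              t(2,3)[unfolded args_def v_def], of up]
          unfolding v_def[symmetric] by blast
        have "occurs_between T b e c \<longleftrightarrow> b < e \<and> (if up then v ! k < ans else ans < v ! k)"
          using ans(2) by (cases "b < e") (auto simp: occurs_between_def)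
        moreover have "real t' \<le> real ?Ct * lg n ^ kt"
          using t'(1) t(1) time by linarith
        moreover have "\<forall>x\<in>set [b, e, c]. x < 2 ^ w"
        proof -
          have "\<sigma> \<le> \<sigma> * n"
            using n1 by simp
          then have "\<sigma> \<le> H"
            unfolding H_def add_mult_distrib by linarith
          then show ?thesis
            using bec H_less \<open>n \<le> H\<close> by auto
        qed
        ultimately show "case q of (args, ans) \<Rightarrow> (\<forall>x\<in>set args. x < 2 ^ w) \<and>
            (\<exists>t. real t \<le> real ?Ct * lg n ^ kt \<and>
              (let s = (step w ?P ^^ t) (initial_config (n # D) args) in halted ?P s \<and> regs s 0 = ans))"
          using t'(2) unfolding q by auto
      qed
    qed
  qed
qed

theorem theorem1p4:
  assumes "\<exists>Q \<in> {sum_queries, all_zero_queries, square_all_zero_queries,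
                  equality_queries, square_lce_queries, line_lce_queries}.
             has_slp2_data_structure Q"
  shows "has_slp1_data_structure symbol_occurrence_queries"
proof -
  have "has_slp1_data_structure symbol_occurrence_queries"
    if "has_slp2_data_structure Q"
      \<comment> \<open>Each entry pairs a query type with the argument indices, the direction of
        the final comparison and the index of the threshold.\<close>
      "(Q, srcs, up, k) \<in> {(sum_queries, [4, 5, 2, 3], True, 1),
         (all_zero_queries, [4, 5, 2, 3], False, 0), (square_all_zero_queries, [7, 8, 3], False, 0),
         (equality_queries, [5, 0, 0, 6, 6, 7], False, 0), (square_lce_queries, [5, 0, 6, 6], False, 7),
         (line_lce_queries, [5, 0, 6, 6, 0], False, 7)}" for Q and srcs :: "nat list" and up and k :: nat
  proof (rule has_slp1_data_structure_via_call[OF that(1), of srcs up k])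
    show "call_correct Q srcs up k"
      using that(2) call_correct_sum call_correct_all_zero call_correct_square_all_zero
        call_correct_equality call_correct_square_lce call_correct_line_lce by auto
  qed (use that(2) in auto)
  with assms show ?thesis
    by blast
qed

end
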